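(* Let $m,n\ge2$ be fixed while $d\to\infty$, and suppose assumptions (A1), (A2), (A3) and (A4) stated in the context hold. Let $\varpi$ be an arbitrary permutation of $\{1,\dots,N\}$, $N=m+n$, and let $\overline\sigma_d^2=d^{-1}\mathrm{tr}(\Sigma_X)$. Let $U^\varpi_{\mathrm{CvM}},U^\varpi_{\mathrm{Energy}},U^\varpi_{\mathrm{MMD}},U^\varpi_{\mathrm{CQ}},U^\varpi_{\mathrm{WMW}}$ be the CvM, energy, Gaussian MMD, CQ and WMW statistics computed from $\mathcal X_m^\varpi=\{Z_{\varpi(1)},\dots,Z_{\varpi(m)}\}$ and $\mathcal Y_n^\varpi=\{Z_{\varpi(m+1)},\dots,Z_{\varpi(N)}\}$. Assume that the bandwidth of the Gaussian kernel satisfies $\varsigma_d^2\asymp d$. Then, as $d\to\infty$, $$\sqrt d\,U^\varpi_{\mathrm{CvM}}=\frac1{2\pi\sqrt{3d}\,\overline\sigma_d^2}U^\varpi_{\mathrm{CQ}}+O_{\mathbb P}(d^{-1/2}),\qquad U^\varpi_{\mathrm{Energy}}=\frac1{\sqrt{2d}\,\overline\sigma_d}U^\varpi_{\mathrm{CQ}}+O_{\mathbb P}(d^{-1/2}),$$ $$\sqrt d\,U^\varpi_{\mathrm{WMW}}=\frac1{\sqrt d\,\overline\sigma_d^2}U^\varpi_{\mathrm{CQ}}+O_{\mathbb P}(d^{-1/2}),\qquad \sqrt d\,U^\varpi_{\mathrm{MMD}}=\frac{\sqrt d}{\varsigma_d^2}e^{-d\overline\sigma_d^2/\varsigma_d^2}\,U^\varpi_{\mathrm{CQ}}+O_{\mathbb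 P}(d^{-1/2}).$$
   Context: For each $d$, $X_1,\dots,X_m$ are i.i.d. from $P_X$ and, independently, $Y_1,\dots,Y_n$ i.i.d. from $P_Y$ on $\mathbb{R}^d$ (distributions depending on $d$), with means $\mu_X,\mu_Y$ and positive definite covariance matrices $\Sigma_X,\Sigma_Y$; pooled sample $(Z_1,\dots,Z_N)=(X_1,\dots,X_m,Y_1,\dots,Y_n)$. Standing assumption: for $X\sim P_X,Y\sim P_Y$, $\beta^\top X,\beta^\top Y$ have continuous distribution functions for almost all $\beta$ in the unit sphere. $a_d\asymp b_d$ means $C<|a_d/b_d|<C'$ for some constants $C,C'>0$ and all large $d$. In (A1) and (A3), $Z_1^\ast,Z_2^\ast,Z_3^\ast,Z_4^\ast$ are independent and each follows either $P_X$ or $P_Y$. (A1) $\mathrm{Var}(\|Z_1^\ast-Z_2^\ast\|^2)=O(d)$ and $\mathrm{Var}\{(Z_1^\ast-Z_3^\ast)^\top(Z_2^\ast-Z_3^\ast)\}=O(d)$. (A2) $d^{-1}\mathrm{tr}(\Sigma_X)\to\overline\sigma_X^2$, $d^{-1}\mathrm{tr}(\Sigma_Y)\to\overline\sigma_Y^2$, $d^{-1}\|\mu_X-\mu_Y\|^2\to\overline\delta_{XY}^2$, where $0<\overline\sigma_X^2,\overline\sigma_Y^2<\infty$, $0\le\overline\delta_{XY}^2<\infty$. (A3) $\mathrm{Var}\{(Z_1^\ast-Z_2^\ast)^\top(Z_3^\ast-Z_4^\ast)\}=O(d)$. (A4) $\Sigma_X=\Sigma_Y$ and $\|\mu_X-\mu_Y\|^2=O(\sqrt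 d)$. Statistics (sums over $i_1\ne i_2$ in $\{1,\dots,m\}$ and $j_1\ne j_2$ in $\{1,\dots,n\}$; $\mathsf{Ang}(u,v)=\arccos\{u^\top v/(\|u\|\|v\|)\}$; $c_{m,n}=\{m(m-1)n(n-1)\}^{-1}$): $U_{\mathrm{CvM}}=c_{m,n}\sum\sum\{\frac13-\frac1{2\pi}\mathsf{Ang}(X_{i_1}-Y_{j_1},X_{i_2}-Y_{j_1})-\frac1{2\pi}\mathsf{Ang}(Y_{j_1}-X_{i_1},Y_{j_2}-X_{i_1})\}$; $U_{\mathrm{CQ}}=c_{m,n}\sum\sum(X_{i_1}-Y_{j_1})^\top(X_{i_2}-Y_{j_2})$; $U_{\mathrm{WMW}}=c_{m,n}\sum\sum\frac{(X_{i_1}-Y_{j_1})^\top(X_{i_2}-Y_{j_2})}{\|X_{i_1}-Y_{j_1}\|\,\|X_{i_2}-Y_{j_2}\|}$; $U_{\mathrm{Energy}}=\frac2{mn}\sum_{i,j}\|X_i-Y_j\|-\frac1{m(m-1)}\sum\|X_{i_1}-X_{i_2}\|-\frac1{n(n-1)}\sum\|Y_{j_1}-Y_{j_2}\|$; $U_{\mathrm{MMD}}=\frac1{m(m-1)}\sum k(X_{i_1},X_{i_2})+\frac1{n(n-1)}\sum k(Y_{j_1},Y_{j_2})-\frac2{mn}\sum_{i,j}k(X_i,Y_j)$ with $k(x,y)=\exp(-\|x-y\|^2/(2\varsigma_d^2))$.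
   Formalization: The coefficient of U_CQ in the WMW expansion is corrected from 1/(√d σ̄_d²) to 1/(2√d σ̄_d²), since each denominator is asymptotically 2dσ̄_d²; the printed coefficient fails for standard Gaussian samples with m = n = 2. *)

theory Defs
  imports "HOL-Probability.Probability"
begin

text \<open>Since the dimension \<open>d\<close> tends to infinity, it cannot be a type.  Vectors of
  \<open>\<real>\<^sup>d\<close> are functions \<open>nat \<Rightarrow> real\<close> of which only the coordinates in \<open>{..<d}\<close> matter; the
  Borel space of \<open>\<real>\<^sup>d\<close> is the product space below.  The Euclidean norm is \<open>L2_set x {..<d}\<close>.\<close>

type_synonym rvec = "nat \<Rightarrow> real"

definition Rd :: "nat \<Rightarrow> rvec measure" where
  "Rd d = (\<Pi>\<^sub>M i\<in>{..<d}. borel)"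

definition inner_d :: "nat \<Rightarrow> rvec \<Rightarrow> rvec \<Rightarrow> real" where
  "inner_d d u v = (\<Sum>i<d. u i * v i)"

definition norm_d :: "nat \<Rightarrow> rvec \<Rightarrow> real" where
  "norm_d d u = L2_set u {..<d}"

text \<open>Normalised surface measure on the unit sphere of \<open>\<real>\<^sup>d\<close> (\<open>d \<ge> 1\<close>), as the cone measure: the
  image of the uniform distribution on the unit ball under \<open>x \<mapsto> x / \<parallel>x\<parallel>\<close>.\<close>

definition sphere_measure :: "nat \<Rightarrow> rvec measure" where
  "sphere_measure d =
     distr (uniform_measure (\<Pi>\<^sub>M i\<in>{..<d}. lborel) {x \<in> space (Rd d). norm_d d x \<le> 1}) (Rd d)
       (\<lambda>x. \<lambda>i\<in>{..<d}. x i / norm_d d x)"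

definition mean_vec :: "rvec measure \<Rightarrow> rvec" where
  "mean_vec P i = (\<integral>x. x i \<partial>P)"

definition cov_mat :: "rvec measure \<Rightarrow> nat \<Rightarrow> nat \<Rightarrow> real" where
  "cov_mat P i j = (\<integral>x. (x i - mean_vec P i) * (x j - mean_vec P j) \<partial>P)"

definition trace_d :: "nat \<Rightarrow> (nat \<Rightarrow> nat \<Rightarrow> real) \<Rightarrow> real" where
  "trace_d d A = (\<Sum>i<d. A i i)"

definition pos_def_d :: "nat \<Rightarrow> (nat \<Rightarrow> nat \<Rightarrow> real) \<Rightarrow> bool" where
  "pos_def_d d A \<longleftrightarrow>
     (\<forall>i<d. \<forall>j<d. A i j = A j i) \<and>
     (\<forall>v::rvec. (\<exists>i<d. v i \<noteq> 0) \<longrightarrow> (\<Sum>i<d. \<Sum>j<d. v i * A i j * v j) > 0)"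

text \<open>The standing assumptions on the distributions.  Finiteness of second moments is explicit
  because the Bochner integral of a non-integrable function is 0.\<close>

definition admissible_law :: "nat \<Rightarrow> rvec measure \<Rightarrow> bool" where
  "admissible_law d P \<longleftrightarrow>
     prob_space P \<and> sets P = sets (Rd d) \<and>
     (\<forall>i<d. integrable P (\<lambda>x. (x i)\<^sup>2)) \<and>
     pos_def_d d (cov_mat P) \<and>
     (AE \<beta> in sphere_measure d.
        continuous_on UNIV (cdf (distr P borel (\<lambda>x. inner_d d \<beta> x))))"

text \<open>The samples are \<open>X 1, \<dots>, X m\<close> and \<open>Y 1, \<dots>, Y n\<close>; the pooled sample is indexed by
  \<open>{1..m + n}\<close>.\<close>

definition pooled :: "nat \<Rightarrow> (nat \<Rightarrow> 'b) \<Rightarrow> (nat \<Rightarrow> 'b) \<Rightarrow> nat \<Rightarrow> 'b" where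
  "pooled m X Y k = (if k \<le> m then X k else Y (k - m))"

definition two_samples ::
  "nat \<Rightarrow> nat \<Rightarrow> nat \<Rightarrow> rvec measure \<Rightarrow> rvec measure \<Rightarrow> 'a measure \<Rightarrow>
   (nat \<Rightarrow> 'a \<Rightarrow> rvec) \<Rightarrow> (nat \<Rightarrow> 'a \<Rightarrow> rvec) \<Rightarrow> bool" where
  "two_samples d m n P Q M X Y \<longleftrightarrow>
     prob_space M \<and>
     prob_space.indep_vars M (\<lambda>_. Rd d) (pooled m X Y) {1..m + n} \<and>
     (\<forall>i\<in>{1..m}. distr M (Rd d) (X i) = P) \<and>
     (\<forall>j\<in>{1..n}. distr M (Rd d) (Y j) = Q)"

text \<open>\<open>Var (f d) = O(g d)\<close>, which includes that the variance is finite for all large \<open>d\<close>.\<close>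

definition variance_bigo ::
  "(nat \<Rightarrow> 'b measure) \<Rightarrow> (nat \<Rightarrow> 'b \<Rightarrow> real) \<Rightarrow> (nat \<Rightarrow> real) \<Rightarrow> bool" where
  "variance_bigo M f g \<longleftrightarrow>
     (\<forall>\<^sub>F d in sequentially. integrable (M d) (\<lambda>x. (f d x)\<^sup>2)) \<and>
     (\<lambda>d. prob_space.variance (M d) (f d)) \<in> O(g)"

text \<open>In the next two conditions the independent \<open>Z\<^sup>*\<close>'s are the coordinates of a product space, and
  \<open>Q1, Q2, \<dots>\<close> range over all choices of their laws.\<close>

definition condA1 :: "(nat \<Rightarrow> rvec measure) \<Rightarrow> (nat \<Rightarrow> rvec measure) \<Rightarrow> bool" where
  "condA1 P Q \<longleftrightarrow>
     (\<forall>Q1\<in>{P, Q}. \<forall>Q2\<in>{P, Q}.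
        variance_bigo (\<lambda>d. Q1 d \<Otimes>\<^sub>M Q2 d) (\<lambda>d (z1, z2). (norm_d d (z1 - z2))\<^sup>2) (\<lambda>d. real d)) \<and>
     (\<forall>Q1\<in>{P, Q}. \<forall>Q2\<in>{P, Q}. \<forall>Q3\<in>{P, Q}.
        variance_bigo (\<lambda>d. Q1 d \<Otimes>\<^sub>M Q2 d \<Otimes>\<^sub>M Q3 d)
          (\<lambda>d (z1, z2, z3). inner_d d (z1 - z3) (z2 - z3)) (\<lambda>d. real d))"

definition condA2 ::
  "(nat \<Rightarrow> rvec measure) \<Rightarrow> (nat \<Rightarrow> rvec measure) \<Rightarrow> real \<Rightarrow> real \<Rightarrow> real \<Rightarrow> bool" where
  "condA2 P Q \<sigma>X2 \<sigma>Y2 \<delta>2 \<longleftrightarrow>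
     0 < \<sigma>X2 \<and> 0 < \<sigma>Y2 \<and> 0 \<le> \<delta>2 \<and>
     (\<lambda>d. trace_d d (cov_mat (P d)) / real d) \<longlonglongrightarrow> \<sigma>X2 \<and>
     (\<lambda>d. trace_d d (cov_mat (Q d)) / real d) \<longlonglongrightarrow> \<sigma>Y2 \<and>
     (\<lambda>d. (norm_d d (mean_vec (P d) - mean_vec (Q d)))\<^sup>2 / real d) \<longlonglongrightarrow> \<delta>2"

definition condA3 :: "(nat \<Rightarrow> rvec measure) \<Rightarrow> (nat \<Rightarrow> rvec measure) \<Rightarrow> bool" where
  "condA3 P Q \<longleftrightarrow>
     (\<forall>Q1\<in>{P, Q}. \<forall>Q2\<in>{P, Q}. \<forall>Q3\<in>{P, Q}. \<forall>Q4\<in>{P, Q}.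
        variance_bigo (\<lambda>d. Q1 d \<Otimes>\<^sub>M Q2 d \<Otimes>\<^sub>M Q3 d \<Otimes>\<^sub>M Q4 d)
          (\<lambda>d (z1, z2, z3, z4). inner_d d (z1 - z2) (z3 - z4)) (\<lambda>d. real d))"

definition condA4 :: "(nat \<Rightarrow> rvec measure) \<Rightarrow> (nat \<Rightarrow> rvec measure) \<Rightarrow> bool" where
  "condA4 P Q \<longleftrightarrow>
     (\<forall>d\<ge>1. \<forall>i<d. \<forall>j<d. cov_mat (P d) i j = cov_mat (Q d) i j) \<and>
     (\<lambda>d. (norm_d d (mean_vec (P d) - mean_vec (Q d)))\<^sup>2) \<in> O(\<lambda>d. sqrt (real d))"

definition sigma2_d :: "nat \<Rightarrow> rvec measure \<Rightarrow> real" where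
  "sigma2_d d P = trace_d d (cov_mat P) / real d"

definition same_order :: "(nat \<Rightarrow> real) \<Rightarrow> (nat \<Rightarrow> real) \<Rightarrow> bool" where
  "same_order a b \<longleftrightarrow>
     (\<exists>C>0. \<exists>C'>0. \<forall>\<^sub>F d in sequentially. C < \<bar>a d / b d\<bar> \<and> \<bar>a d / b d\<bar> < C')"

text \<open>\<open>R d = O\<^sub>P(r d)\<close>, where \<open>R d\<close> is a random variable on \<open>M d\<close>.\<close>

definition bigo_prob ::
  "(nat \<Rightarrow> 'a measure) \<Rightarrow> (nat \<Rightarrow> 'a \<Rightarrow> real) \<Rightarrow> (nat \<Rightarrow> real) \<Rightarrow> bool" where
  "bigo_prob M R r \<longleftrightarrow>
     (\<forall>\<^sub>F d in sequentially. R d \<in> borel_measurable (M d)) \<and>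
     (\<forall>\<epsilon>>0. \<exists>C>0. \<forall>\<^sub>F d in sequentially.
        measure (M d) {\<omega> \<in> space (M d). \<bar>R d \<omega>\<bar> > C * \<bar>r d\<bar>} < \<epsilon>)"

text \<open>The statistics, as functions of sample values \<open>x 1, \<dots>, x m\<close> and \<open>y 1, \<dots>, y n\<close>.  A zero
  denominator makes the quotient 0; under the standing assumptions this has probability 0.\<close>

definition Ang :: "nat \<Rightarrow> rvec \<Rightarrow> rvec \<Rightarrow> real" where
  "Ang d u v = arccos (inner_d d u v / (norm_d d u * norm_d d v))"

definition c_mn :: "nat \<Rightarrow> nat \<Rightarrow> real" where
  "c_mn m n = 1 / (real m * (real m - 1) * real n * (real n - 1))"

definition U_CvM :: "nat \<Rightarrow> nat \<Rightarrow> nat \<Rightarrow> (nat \<Rightarrow> rvec) \<Rightarrow> (nat \<Rightarrow> rvec) \<Rightarrow> real" where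
  "U_CvM d m n x y =
     c_mn m n * (\<Sum>i1 = 1..m. \<Sum>i2\<in>{1..m} - {i1}. \<Sum>j1 = 1..n. \<Sum>j2\<in>{1..n} - {j1}.
       1 / 3 - 1 / (2 * pi) * Ang d (x i1 - y j1) (x i2 - y j1)
             - 1 / (2 * pi) * Ang d (y j1 - x i1) (y j2 - x i1))"

definition U_CQ :: "nat \<Rightarrow> nat \<Rightarrow> nat \<Rightarrow> (nat \<Rightarrow> rvec) \<Rightarrow> (nat \<Rightarrow> rvec) \<Rightarrow> real" where
  "U_CQ d m n x y =
     c_mn m n * (\<Sum>i1 = 1..m. \<Sum>i2\<in>{1..m} - {i1}. \<Sum>j1 = 1..n. \<Sum>j2\<in>{1..n} - {j1}.
       inner_d d (x i1 - y j1) (x i2 - y j2))"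

text \<open>Each denominator is asymptotic to \<open>2 * d * \<sigma>\<^sup>2\<close>, so the coefficient of \<open>U_CQ\<close> in the
  expansion of \<open>sqrt d * U_WMW\<close> is \<open>1 / (2 * sqrt d * \<sigma>\<^sup>2)\<close>.  The source prints
  \<open>1 / (sqrt d * \<sigma>\<^sup>2)\<close>, which is refuted by standard Gaussian samples, for which
  \<open>U_CQ / sqrt d\<close> has a nondegenerate limit.\<close>

definition U_WMW :: "nat \<Rightarrow> nat \<Rightarrow> nat \<Rightarrow> (nat \<Rightarrow> rvec) \<Rightarrow> (nat \<Rightarrow> rvec) \<Rightarrow> real" where
  "U_WMW d m n x y =
     c_mn m n * (\<Sum>i1 = 1..m. \<Sum>i2\<in>{1..m} - {i1}. \<Sum>j1 = 1..n. \<Sum>j2\<in>{1..n} - {j1}.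
       inner_d d (x i1 - y j1) (x i2 - y j2) / (norm_d d (x i1 - y j1) * norm_d d (x i2 - y j2)))"

definition U_Energy :: "nat \<Rightarrow> nat \<Rightarrow> nat \<Rightarrow> (nat \<Rightarrow> rvec) \<Rightarrow> (nat \<Rightarrow> rvec) \<Rightarrow> real" where
  "U_Energy d m n x y =
     2 / (real m * real n) * (\<Sum>i = 1..m. \<Sum>j = 1..n. norm_d d (x i - y j))
     - 1 / (real m * (real m - 1)) * (\<Sum>i1 = 1..m. \<Sum>i2\<in>{1..m} - {i1}. norm_d d (x i1 - x i2))
     - 1 / (real n * (real n - 1)) * (\<Sum>j1 = 1..n. \<Sum>j2\<in>{1..n} - {j1}. norm_d d (y j1 - y j2))"

definition gauss_kernel :: "nat \<Rightarrow> real \<Rightarrow> rvec \<Rightarrow> rvec \<Rightarrow> real" where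
  "gauss_kernel d bw u v = exp (- (norm_d d (u - v))\<^sup>2 / (2 * bw\<^sup>2))"

definition U_MMD ::
  "nat \<Rightarrow> real \<Rightarrow> nat \<Rightarrow> nat \<Rightarrow> (nat \<Rightarrow> rvec) \<Rightarrow> (nat \<Rightarrow> rvec) \<Rightarrow> real" where
  "U_MMD d bw m n x y =
     1 / (real m * (real m - 1)) *
       (\<Sum>i1 = 1..m. \<Sum>i2\<in>{1..m} - {i1}. gauss_kernel d bw (x i1) (x i2))
     + 1 / (real n * (real n - 1)) *
       (\<Sum>j1 = 1..n. \<Sum>j2\<in>{1..n} - {j1}. gauss_kernel d bw (y j1) (y j2))
     - 2 / (real m * real n) * (\<Sum>i = 1..m. \<Sum>j = 1..n. gauss_kernel d bw (x i) (y j))"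

text \<open>The statistic \<open>U\<close> computed from \<open>Z (\<rho> 1), \<dots>, Z (\<rho> m)\<close> as first sample and
  \<open>Z (\<rho> (m + 1)), \<dots>, Z (\<rho> (m + n))\<close> as second sample.\<close>

definition permuted ::
  "((nat \<Rightarrow> rvec) \<Rightarrow> (nat \<Rightarrow> rvec) \<Rightarrow> real) \<Rightarrow> nat \<Rightarrow> (nat \<Rightarrow> nat) \<Rightarrow>
   (nat \<Rightarrow> 'a \<Rightarrow> rvec) \<Rightarrow> 'a \<Rightarrow> real" where
  "permuted U m \<rho> Z \<omega> = U (\<lambda>i. Z (\<rho> i) \<omega>) (\<lambda>j. Z (\<rho> (m + j)) \<omega>)"

end

(* Polarisation expresses all five statistics through the squared distances D between distinct
   points of the pooled sample.  Under (A1), (A2) and (A4) Chebyshev's inequality gives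
   D = s + O_P(sqrt d) with the same s = 2 tr(Sigma_X), of exact order d, for every pair, so a
   permutation of the sample changes nothing.  Expanding sqrt, exp and arccos (around 1/2) to
   second order in the relative deviation D / s - 1 = O_P(1 / sqrt d), the constants cancel, the
   linear parts average to multiples of U_CQ, and the remainders are of relative order O_P(1 / d).  *)

theory Submission
  imports Defs
begin

subsection \<open>Second-order expansions\<close>

text \<open>Probability and analysis are kept apart. The random input is one event: finitely many
  pairs of sample points have squared distances within \<open>K * sqrt d\<close> of
  \<open>s d\<close>. Chebyshev's inequality is applied pair by pair and a union bound joins the
  pairs; on the event all estimates are deterministic and uniform in the sample point. A common
  centre exists because (A4) lets the squared mean difference grow only like \<open>sqrt d\<close>,
  the order of the random fluctuations themselves. A linear expansion with quadratic remainder is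
  forced by the rate: after multiplication by \<open>sqrt d\<close> the error must still be O(1 /
  \<open>sqrt d\<close>), so the unscaled error must be O(1 / d). The energy statistic already
  carries a factor \<open>sqrt d\<close> inside its distances. The point 1/2 for arccos is the
  cosine in an equilateral triangle, the shape of three nearly equidistant points: two angles
  \<open>pi / 3\<close>, each weighted by \<open>1 / (2 * pi)\<close>, use up the constant 1/3. WMW
  has no constant to cancel: its numerators are already linear in the deviations, so a first-order
  estimate of the denominators is enough. Numerical constants such as 1/16, 11 or 40 are convenient,
  not optimal.\<close>

lemma sqrt_linear_approx:
  assumes "- 1 \<le> (t::real)"
  shows "\<bar>sqrt (1 + t) - 1 - t / 2\<bar> \<le> t\<^sup>2 / 2"
proof -
  define q where "q = sqrt (1 + t)"
  have q: "0 \<le> q" "t = q\<^sup>2 - 1" using assms by (auto simp: q_def)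
  \<comment> \<open>In terms of \<open>q\<close> the remainder is an exact square, so the bound
    holds down to the end point \<open>t = - 1\<close>.\<close>
  have "q - 1 - t / 2 = - ((q - 1)\<^sup>2 / 2)" by (simp add: q(2) power2_eq_square field_simps)
  moreover have "\<bar>q - 1\<bar> * 1 \<le> \<bar>q - 1\<bar> * (q + 1)" using q(1) by (intro mult_left_mono) auto
  then have "\<bar>q - 1\<bar> \<le> \<bar>t\<bar>" using q
    by (simp add: q(2) power2_eq_square square_diff_one_factored abs_mult mult.commute)
  then have "(q - 1)\<^sup>2 \<le> t\<^sup>2" by (simp add: abs_le_square_iff)
  ultimately show ?thesis unfolding q_def[symmetric] by simp
qed

text \<open>With \<open>q = sqrt (1 + t)\<close> the error is exactly
  \<open>(q - 1)\<^sup>2 * ((q + 2) / (2 * q))\<close>, while \<open>t\<^sup>2\<close> is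
  \<open>(q - 1)\<^sup>2 * (q + 1)\<^sup>2\<close>. Only the quotient of the two cofactors needs a
  bound, and keeping \<open>q\<close> away from 0 gives it.\<close>

lemma inverse_sqrt_linear_approx:
  assumes "\<bar>t::real\<bar> \<le> 1 / 2"
  shows "\<bar>1 / sqrt (1 + t) - 1 + t / 2\<bar> \<le> 2 * t\<^sup>2"
proof -
  define q where "q = sqrt (1 + t)"
  have q: "0 < q" "t = q\<^sup>2 - 1" using assms by (auto simp: q_def)
  \<comment> \<open>The sharp bound would be \<open>q \<ge> sqrt (1 / 2)\<close>; the rational value
    1/2 is weaker and yields the factor \<open>1 \<le> 2 * q\<close> used below.\<close>
  have "(1/2)\<^sup>2 \<le> (1/2::real)" by (simp add: power2_eq_square)
  also have "\<dots> \<le> q\<^sup>2" using assms q(2) by linarith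
  finally have "(1/2)\<^sup>2 \<le> q\<^sup>2" .
  then have q2: "1 / 2 \<le> q" by (rule power2_le_imp_le) (use q in auto)
  have eq: "1 / q - 1 + t / 2 = (q - 1)\<^sup>2 * ((q + 2) / (2 * q))"
    using q(1) by (simp add: q(2) power2_eq_square field_simps)
  have "(q + 2) / (2 * q) \<le> 2 * (q + 1)\<^sup>2"
  proof -
    have "q + 2 \<le> 1 * (4 * (q + 1)\<^sup>2) / 2"
      using q by (simp add: power2_eq_square field_simps)
    also have "\<dots> \<le> (2 * q) * (4 * (q + 1)\<^sup>2) / 2"
      using q2 by (intro divide_right_mono mult_right_mono) auto
    finally show ?thesis using q(1) by (simp add: field_simps)
  qed
  then have "(q - 1)\<^sup>2 * ((q + 2) / (2 * q)) \<le> (q - 1)\<^sup>2 * (2 * (q + 1)\<^sup>2)"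
    by (intro mult_left_mono) auto
  also have "\<dots> = 2 * t\<^sup>2" unfolding q(2) by (simp add: power2_eq_square algebra_simps)
  finally show ?thesis using q(1) eq unfolding q_def[symmetric] by simp
qed

text \<open>Taylor's formula of order one. The remainder of \<open>field_Taylor\<close> is divided
  by \<open>fact 1\<close>, so the usual factor 1/2 is given away.\<close>

lemma second_order_bound:
  fixes f f' f'' :: "real \<Rightarrow> real"
  assumes "\<And>z. \<bar>z - a\<bar> \<le> r \<Longrightarrow> (f has_real_derivative f' z) (at z)"
    and "\<And>z. \<bar>z - a\<bar> \<le> r \<Longrightarrow> (f' has_real_derivative f'' z) (at z)"
    and "\<And>z. \<bar>z - a\<bar> \<le> r \<Longrightarrow> \<bar>f'' z\<bar> \<le> B"
    and "\<bar>x - a\<bar> \<le> r"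
  shows "\<bar>f x - f a - f' a * (x - a)\<bar> \<le> B * (x - a)\<^sup>2"
proof -
  define g where "g i = (if i = 0 then f else if i = 1 then f' else f'')" for i :: nat
  have S: "z \<in> cball a r \<longleftrightarrow> \<bar>z - a\<bar> \<le> r" for z by (auto simp: dist_real_def)
  have "norm (g 0 x - (\<Sum>i\<le>1. g i a * (x - a) ^ i / fact i)) \<le> B * norm (x - a) ^ Suc 1 / fact 1"
  proof (rule field_Taylor)
    show "convex (cball a r)" by simp
    show "(g i has_real_derivative g (Suc i) z) (at z within cball a r)"
      if "z \<in> cball a r" "i \<le> 1" for i z
    proof (cases i)
      case 0
      then show ?thesis using assms(1)[of z] that unfolding S g_def
        by (simp add: has_field_derivative_at_within)
    next
      case (Suc k)
      then show ?thesis using assms(2)[of z] that unfolding S g_def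
        by (simp add: has_field_derivative_at_within)
    qed
    show "norm (g (Suc 1) z) \<le> B" if "z \<in> cball a r" for z
      using assms(3)[of z] that unfolding S g_def by simp
    have "0 \<le> r" using assms(4) by linarith
    then show "a \<in> cball a r" "x \<in> cball a r" using assms(4) unfolding S by auto
  qed
  then show ?thesis by (simp add: g_def algebra_simps power2_eq_square)
qed

lemma exp_linear_approx:
  assumes "\<bar>u::real\<bar> \<le> 1"
  shows "\<bar>exp (- u) - 1 + u\<bar> \<le> 3 * u\<^sup>2"
proof -
  have "\<bar>exp (- u) - exp 0 - exp 0 * (- u - 0)\<bar> \<le> 3 * (- u - 0)\<^sup>2"
  proof (rule second_order_bound[where r=1])
    \<comment> \<open>The constant 3 is a rational bound for e.\<close>
    show "\<bar>exp z\<bar> \<le> 3" if "\<bar>z - 0\<bar> \<le> 1" for z :: real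
    proof -
      have "exp z \<le> exp 1" using that by simp
      then show ?thesis using exp_le abs_exp_cancel[of z] by linarith
    qed
  qed (use assms in \<open>auto intro: DERIV_exp\<close>)
  then show ?thesis by simp
qed

text \<open>The radius 1/4 around 1/2 keeps the argument below 3/4, away from the singularity of the
  derivative at 1.\<close>

lemma arccos_linear_approx:
  assumes "\<bar>x - 1 / 2\<bar> \<le> 1 / 4"
  shows "\<bar>arccos x - pi / 3 + 2 / sqrt 3 * (x - 1 / 2)\<bar> \<le> 4 * (x - 1 / 2)\<^sup>2"
proof -
  define f' where "f' x = - (1 / sqrt (1 - x\<^sup>2))" for x :: real
  define f'' where "f'' x = - (x / ((1 - x\<^sup>2) * sqrt (1 - x\<^sup>2)))" for x :: real
  have rng: "1/4 \<le> z" "z \<le> 3/4" "7/16 \<le> 1 - z\<^sup>2" if "\<bar>z - 1/2\<bar> \<le> 1/4" for z :: real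
  proof -
    show 1: "1/4 \<le> z" and 2: "z \<le> 3/4" using that by linarith+
    have "z\<^sup>2 \<le> (3/4)\<^sup>2" using 1 2 by (intro power_mono) auto
    then show "7/16 \<le> 1 - z\<^sup>2" by (simp add: power2_eq_square)
  qed
  have a60: "arccos (1/2) = pi / 3" by (intro arccos_unique) (auto simp: cos_60)
  have "1 - (1/2)\<^sup>2 = 3 / (2\<^sup>2::real)" by (simp add: power2_eq_square)
  then have f'0: "f' (1/2) = - (2 / sqrt 3)"
    unfolding f'_def by (simp only: real_sqrt_divide real_sqrt_abs) simp
  have "\<bar>arccos x - arccos (1/2) - f' (1/2) * (x - 1/2)\<bar> \<le> 4 * (x - 1/2)\<^sup>2"
  proof (rule second_order_bound[where r="1/4" and f''=f''])
    fix z :: real assume z: "\<bar>z - 1/2\<bar> \<le> 1/4"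
    note r = rng[OF z]
    show "(arccos has_real_derivative f' z) (at z)"
      using DERIV_arccos[of z] r by (simp add: f'_def inverse_eq_divide)
    have pos: "0 < 1 - z\<^sup>2" using r by linarith
    show "(f' has_real_derivative f'' z) (at z)"
      unfolding f'_def f''_def using pos
      by (auto intro!: derivative_eq_intros simp: field_simps power2_eq_square)
    have s: "1/2 \<le> sqrt (1 - z\<^sup>2)" by (rule real_le_rsqrt) (use r in \<open>simp add: power2_eq_square\<close>)
    \<comment> \<open>The second derivative is at most (3/4) / (7/32) = 24/7 in absolute value,
      hence below 4.\<close>
    have "(7/16) * (1/2) \<le> (1 - z\<^sup>2) * sqrt (1 - z\<^sup>2)" using r s by (intro mult_mono) auto
    then have "z \<le> 4 * ((1 - z\<^sup>2) * sqrt (1 - z\<^sup>2))" using r by linarith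
    then show "\<bar>f'' z\<bar> \<le> 4" unfolding f''_def using r pos by (simp add: divide_le_eq abs_mult)
  qed (use assms in auto)
  then show ?thesis by (simp add: a60 f'0)
qed

section \<open>Expansions in squared distances around a common value \<open>s\<close>\<close>

lemma sqrt_dist_approx:
  assumes "0 < s" "\<tau> \<le> 1" "\<bar>D - s\<bar> \<le> \<tau> * s"
  shows "\<bar>sqrt D - sqrt s - (D - s) / (2 * sqrt s)\<bar> \<le> sqrt s * \<tau>\<^sup>2 / 2"
proof -
  define t where "t = D / s - 1"
  have D: "D = s * (1 + t)" and ts: "D - s = s * t" using assms(1) by (auto simp: t_def field_simps)
  have t: "\<bar>t\<bar> \<le> \<tau>" using assms(1,3) unfolding ts by (simp add: abs_mult mult.commute)
  have ss: "s = sqrt s * sqrt s" using assms(1) by simp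
  have "sqrt D - sqrt s - (D - s) / (2 * sqrt s) = sqrt s * (sqrt (1 + t) - 1 - t / 2)"
  proof -
    have "(D - s) / (2 * sqrt s) = sqrt s * t / 2"
      unfolding ts using assms(1) by (simp add: field_simps)
    moreover have "sqrt D = sqrt s * sqrt (1 + t)" unfolding D by (rule real_sqrt_mult)
    ultimately show ?thesis by (simp only: right_diff_distrib mult_1_right times_divide_eq_right)
  qed
  moreover have "\<bar>sqrt (1 + t) - 1 - t / 2\<bar> \<le> t\<^sup>2 / 2"
    using sqrt_linear_approx[of t] t assms(2) by linarith
  moreover have "t\<^sup>2 \<le> \<tau>\<^sup>2" using power_mono[OF t, of 2] by simp
  ultimately have "\<bar>sqrt D - sqrt s - (D - s) / (2 * sqrt s)\<bar> \<le> sqrt s * (\<tau>\<^sup>2 / 2)"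
    using assms(1) by (auto simp: abs_mult intro!: mult_left_mono)
  then show ?thesis by simp
qed

lemma inverse_dist_product_approx:
  assumes "0 < s" "\<tau> \<le> 1 / 16" "\<bar>D1 - s\<bar> \<le> \<tau> * s" "\<bar>D2 - s\<bar> \<le> \<tau> * s"
  shows "\<bar>s / (sqrt D1 * sqrt D2) - 1 + ((D1 - s) + (D2 - s)) / (2 * s)\<bar> \<le> 11 * \<tau>\<^sup>2"
proof -
  define t1 t2 where "t1 = D1 / s - 1" and "t2 = D2 / s - 1"
  have D: "D1 = s * (1 + t1)" "D2 = s * (1 + t2)" "D1 - s = s * t1" "D2 - s = s * t2"
    using assms(1) by (auto simp: t1_def t2_def field_simps)
  have t: "\<bar>t1\<bar> \<le> \<tau>" "\<bar>t2\<bar> \<le> \<tau>"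
    using assms(1,3,4) unfolding D(3,4) by (simp_all add: abs_mult mult.commute)
  have \<tau>0: "0 \<le> \<tau>" using t by linarith
  \<comment> \<open>\<open>1 + T\<close> is the product of \<open>1 + t1\<close> and
    \<open>1 + t2\<close>, so the expansion in one variable applies;
    \<open>\<tau> \<le> 1 / 16\<close> absorbs the mixed term \<open>t1 * t2\<close> into the factor
    17/8.\<close>
  define T where "T = t1 + t2 + t1 * t2"
  have tt: "\<bar>t1 * t2\<bar> \<le> \<tau>\<^sup>2" using t by (auto simp: abs_mult power2_eq_square intro: mult_mono)
  have "\<tau>\<^sup>2 \<le> \<tau> / 16" using assms(2) \<tau>0
    using mult_left_mono[of \<tau> "1/16" \<tau>] by (simp add: power2_eq_square)
  then have T: "\<bar>T\<bar> \<le> 17/8 * \<tau>" unfolding T_def using t tt by linarith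
  have "T\<^sup>2 \<le> (17/8 * \<tau>)\<^sup>2" using power_mono[OF T, of 2] by simp
  also have "(17/8 * \<tau>)\<^sup>2 = 289/64 * \<tau>\<^sup>2" by (simp add: power2_eq_square)
  finally have T2: "2 * T\<^sup>2 \<le> 10 * \<tau>\<^sup>2" using zero_le_power2[of \<tau>] by linarith
  have "sqrt D1 * sqrt D2 = sqrt (s\<^sup>2 * (1 + T))"
    unfolding real_sqrt_mult[symmetric] D T_def by (simp add: power2_eq_square algebra_simps)
  also have "\<dots> = s * sqrt (1 + T)" using assms(1) by (simp add: real_sqrt_mult)
  finally have "s / (sqrt D1 * sqrt D2) = 1 / sqrt (1 + T)" using assms(1) by simp
  moreover have "((D1 - s) + (D2 - s)) / (2 * s) = (t1 + t2) / 2"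
    unfolding D(3,4) using assms(1) by (simp add: field_simps)
  moreover have "\<bar>1 / sqrt (1 + T) - 1 + T / 2\<bar> \<le> 2 * T\<^sup>2"
    by (rule inverse_sqrt_linear_approx) (use T assms(2) in linarith)
  moreover have "T / 2 = (t1 + t2) / 2 + t1 * t2 / 2" by (simp add: T_def)
  ultimately show ?thesis using T2 tt by linarith
qed

text \<open>Two first-order small quantities multiply to a second-order one. This allows a factor
  \<open>p\<close> near 1 to be replaced by 1 next to a small \<open>L\<close>.\<close>

lemma product_approx:
  fixes a b L p \<tau> :: real
  assumes "\<bar>p - 1\<bar> \<le> a * \<tau>" "\<bar>L\<bar> \<le> b * \<tau>"
  shows "\<bar>L * p - L\<bar> \<le> a * b * \<tau>\<^sup>2"
proof -
  have "L * p - L = L * (p - 1)" by (simp add: algebra_simps)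
  also have "\<bar>\<dots>\<bar> \<le> (b * \<tau>) * (a * \<tau>)"
    unfolding abs_mult using assms by (intro mult_mono) auto
  finally show ?thesis by (simp add: power2_eq_square mult_ac)
qed

text \<open>The first-order version: the linear term costs at most \<open>\<tau>\<close>, and
  \<open>11 * \<tau>\<^sup>2 \<le> \<tau>\<close> because
  \<open>\<tau> \<le> 1 / 11\<close>.\<close>

lemma inverse_dist_product_crude:
  assumes "0 < s" "\<tau> \<le> 1 / 16" "\<bar>D1 - s\<bar> \<le> \<tau> * s" "\<bar>D2 - s\<bar> \<le> \<tau> * s"
  shows "\<bar>s / (sqrt D1 * sqrt D2) - 1\<bar> \<le> 2 * \<tau>"
proof -
  have "\<bar>((D1 - s) + (D2 - s)) / (2 * s)\<bar> \<le> \<tau>"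
    using assms by (simp add: abs_le_iff field_simps)
  moreover from this have "0 \<le> \<tau>" by linarith
  then have "11 * \<tau>\<^sup>2 \<le> \<tau>"
    using mult_left_mono[of \<tau> "1/11" \<tau>] assms(2) by (simp add: power2_eq_square)
  ultimately show ?thesis using inverse_dist_product_approx[OF assms] by linarith
qed

text \<open>The signs in the numerator cancel \<open>s\<close>, so relative to \<open>s\<close> it
  is O(\<open>\<tau>\<close>); an O(\<open>\<tau>\<close>) error in the denominator then changes the
  quotient by O(\<open>\<tau>\<^sup>2\<close>).\<close>

lemma spatial_sign_approx:
  assumes "0 < s" "\<tau> \<le> 1 / 16"
    and "\<And>D. D \<in> {D1, D2, D3, D4, D5, D6} \<Longrightarrow> \<bar>D - s\<bar> \<le> \<tau> * s"
  shows "\<bar>((D1 + D2 - D3 - D4) / 2) / (sqrt D5 * sqrt D6) - ((D1 + D2 - D3 - D4) / 2) / s\<bar>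
    \<le> 4 * \<tau>\<^sup>2"
proof -
  define L where "L = ((D1 + D2 - D3 - D4) / 2) / s"
  define p where "p = s / (sqrt D5 * sqrt D6)"
  have p: "\<bar>p - 1\<bar> \<le> 2 * \<tau>"
    unfolding p_def by (rule inverse_dist_product_crude) (use assms in auto)
  have "\<bar>(D1 + D2 - D3 - D4) / 2\<bar> \<le> 2 * \<tau> * s"
    using assms(3)[of D1] assms(3)[of D2] assms(3)[of D3] assms(3)[of D4] by auto
  then have "\<bar>L\<bar> \<le> 2 * \<tau>" unfolding L_def using assms(1) by (simp add: abs_divide pos_divide_le_eq)
  from product_approx[OF p this] show ?thesis
    unfolding L_def p_def using assms(1) by simp
qed

text \<open>By the law of cosines the argument of arccos is the cosine of an angle in a triangle
  with squared sides \<open>D1\<close>, \<open>D2\<close>, \<open>D3\<close>, and \<open>D3\<close>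
  is opposite. Here the numerator has the nonzero limit \<open>s / 2\<close>, so the denominator
  must be expanded to second order; this is why adjacent sides enter with weight 1/4 and not
  1/2.\<close>

lemma angle_approx:
  assumes "0 < s" "\<tau> \<le> 1 / 16"
    and "\<And>D. D \<in> {D1, D2, D3} \<Longrightarrow> \<bar>D - s\<bar> \<le> \<tau> * s"
  shows "\<bar>arccos (((D1 + D2 - D3) / 2) / (sqrt D1 * sqrt D2)) - pi / 3
    + 2 / sqrt 3 * (((D1 + D2) / 4 - D3 / 2) / s)\<bar> \<le> 40 * \<tau>\<^sup>2"
proof -
  define t1 t2 t3 where "t1 = D1 / s - 1" and "t2 = D2 / s - 1" and "t3 = D3 / s - 1"
  have D: "D1 = s * (1 + t1)" "D2 = s * (1 + t2)" "D3 = s * (1 + t3)"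
    using assms(1) by (auto simp: t1_def t2_def t3_def field_simps)
  have t: "\<bar>t1\<bar> \<le> \<tau>" "\<bar>t2\<bar> \<le> \<tau>" "\<bar>t3\<bar> \<le> \<tau>"
    using assms(1) assms(3)[of D1] assms(3)[of D2] assms(3)[of D3] unfolding D
    by (simp_all add: abs_mult algebra_simps)
  have \<tau>0: "0 \<le> \<tau>" using t by linarith
  define p where "p = s / (sqrt D1 * sqrt D2)"
  define a where "a = (t1 + t2 - t3) / 2"
  define r where "r = ((D1 + D2 - D3) / 2) / (sqrt D1 * sqrt D2)"
  define l where "l = (t1 + t2) / 4 - t3 / 2"
  have r: "r = p / 2 + a * p"
  proof -
    have "(D1 + D2 - D3) / 2 = s * (1 / 2 + a)" unfolding a_def D by (simp add: field_simps)
    then show ?thesis unfolding r_def p_def by (simp add: add_divide_distrib algebra_simps)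
  qed
  have "\<bar>p - 1 + ((D1 - s) + (D2 - s)) / (2 * s)\<bar> \<le> 11 * \<tau>\<^sup>2"
    unfolding p_def by (rule inverse_dist_product_approx) (use assms in auto)
  moreover have "((D1 - s) + (D2 - s)) / (2 * s) = (t1 + t2) / 2"
    unfolding D using assms(1) by (simp add: field_simps)
  ultimately have p: "\<bar>p - 1 + (t1 + t2) / 2\<bar> \<le> 11 * \<tau>\<^sup>2" by (simp only:)
  have "\<bar>a * p - a\<bar> \<le> 2 * (3/2) * \<tau>\<^sup>2"
  proof (rule product_approx)
    show "\<bar>p - 1\<bar> \<le> 2 * \<tau>"
      unfolding p_def by (rule inverse_dist_product_crude) (use assms in auto)
    show "\<bar>a\<bar> \<le> 3/2 * \<tau>" unfolding a_def using t by (simp add: abs_le_iff)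
  qed
  \<comment> \<open>Splits the error of the cosine into the remainder of the denominator (11/2) and
    a product of small quantities (3), together at most 9.\<close>
  moreover have "r - 1/2 - l = (p - 1 + (t1 + t2) / 2) / 2 + (a * p - a)"
    unfolding r l_def a_def by (simp add: field_simps)
  moreover have "\<bar>P / 2 + Q\<bar> \<le> 9 * w" if "\<bar>P\<bar> \<le> 11 * w" "\<bar>Q\<bar> \<le> 3 * w" for P Q w :: real
    using that by linarith
  ultimately have rl: "\<bar>r - 1/2 - l\<bar> \<le> 9 * \<tau>\<^sup>2" using p by simp
  have dl: "((D1 + D2) / 4 - D3 / 2) / s = l"
    unfolding D l_def using assms(1) by (simp add: field_simps)
  have "\<bar>l\<bar> \<le> \<tau>" unfolding l_def using t by (simp add: abs_le_iff field_simps)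
  moreover have "9 * \<tau>\<^sup>2 \<le> \<tau>"
    using mult_left_mono[of \<tau> "1/9" \<tau>] assms(2) \<tau>0 by (simp add: power2_eq_square)
  ultimately have r2: "\<bar>r - 1/2\<bar> \<le> 2 * \<tau>" using rl by linarith
  then have "\<bar>r - 1/2\<bar> \<le> 1/4" using assms(2) by linarith
  from arccos_linear_approx[OF this]
  have "\<bar>arccos r - pi / 3 + 2 / sqrt 3 * (r - 1/2)\<bar> \<le> 4 * (r - 1/2)\<^sup>2" .
  moreover have "(r - 1/2)\<^sup>2 \<le> 4 * \<tau>\<^sup>2" using power_mono[OF r2, of 2] by (simp add: power_mult_distrib)
  moreover have "\<bar>2 / sqrt 3 * (r - 1/2 - l)\<bar> \<le> 2 * (9 * \<tau>\<^sup>2)"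
    unfolding abs_mult using rl by (intro mult_mono) (auto simp: divide_le_eq)
  \<comment> \<open>Budget: 4 * 4 from the curvature of arccos and 2 * 9 from linearising the
    cosine, 34 in total.\<close>
  moreover have "\<bar>E - F\<bar> \<le> 40 * w" if "\<bar>E\<bar> \<le> 4 * v" "v \<le> 4 * w" "\<bar>F\<bar> \<le> 2 * (9 * w)" for E F v w :: real
    using that by linarith
  ultimately have "\<bar>(arccos r - pi / 3 + 2 / sqrt 3 * (r - 1/2)) - 2 / sqrt 3 * (r - 1/2 - l)\<bar> \<le> 40 * \<tau>\<^sup>2"
    by blast
  then show ?thesis unfolding r_def[symmetric] dl by (simp only: right_diff_distrib)
qed

text \<open>The exponent is a distance divided by the squared bandwidth \<open>h\<close>, so the
  deviation is measured relative to \<open>h\<close> and not to \<open>s\<close>. The prefactor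
  \<open>exp (- s / (2 * h))\<close> is at most 1.\<close>

lemma gauss_dist_approx:
  fixes h s D \<eta> :: real
  assumes "0 < h" "0 < s" "\<bar>D - s\<bar> / h \<le> \<eta>" "\<eta> \<le> 1"
  shows "\<bar>exp (- D / (2 * h)) - exp (- s / (2 * h)) + exp (- s / (2 * h)) * (D - s) / (2 * h)\<bar>
    \<le> 3 * \<eta>\<^sup>2"
proof -
  define u where "u = (D - s) / (2 * h)"
  have u: "\<bar>u\<bar> \<le> \<eta>" 
  proof -
    define v where "v = \<bar>D - s\<bar> / h"
    have "\<bar>u\<bar> = v / 2" "0 \<le> v" using assms(1) by (simp_all add: u_def v_def abs_mult)
    then show ?thesis using assms(3) unfolding v_def[symmetric] by linarith
  qed
  have "exp (- D / (2 * h)) = exp (- s / (2 * h)) * exp (- u)"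
    unfolding u_def exp_add[symmetric] by (simp add: diff_divide_distrib)
  then have "exp (- D / (2 * h)) - exp (- s / (2 * h)) + exp (- s / (2 * h)) * (D - s) / (2 * h)
    = exp (- s / (2 * h)) * (exp (- u) - 1 + u)" by (simp add: u_def algebra_simps)
  also have "\<bar>\<dots>\<bar> \<le> 1 * (3 * u\<^sup>2)"
    unfolding abs_mult using exp_linear_approx[of u] u assms by (intro mult_mono) auto
  also have "\<dots> \<le> 3 * \<eta>\<^sup>2" using power_mono[OF u, of 2] by simp
  finally show ?thesis .
qed

subsection \<open>Averages over pairs of pairs\<close>

lemma norm_d_sq: "(norm_d d u)\<^sup>2 = (\<Sum>i<d. (u i)\<^sup>2)"
  by (simp add: norm_d_def L2_set_def sum_nonneg)

lemma norm_d_nonneg [simp]: "0 \<le> norm_d d u"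
  by (simp add: norm_d_def)

lemma norm_d_minus_commute: "norm_d d (u - v) = norm_d d (v - u)"
  by (simp add: norm_d_def L2_set_def power2_commute)

lemma norm_d_eq_sqrt: "norm_d d u = sqrt ((norm_d d u)\<^sup>2)"
  using norm_d_nonneg by simp

text \<open>Turns a CQ summand into cross-sample minus within-sample squared distances. The linear
  terms of the other statistics average to this same combination.\<close>

lemma inner_d_polarization:
  "inner_d d (x - y) (x' - y') = ((norm_d d (x - y'))\<^sup>2 + (norm_d d (x' - y))\<^sup>2
     - (norm_d d (x - x'))\<^sup>2 - (norm_d d (y - y'))\<^sup>2) / 2"
  unfolding norm_d_sq inner_d_def sum.distrib[symmetric] sum_subtractf[symmetric] sum_divide_distrib
  by (intro sum.cong refl) (simp add: power2_eq_square field_simps)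

lemma inner_d_common_point:
  "inner_d d (x - y) (x' - y) =
     ((norm_d d (x - y))\<^sup>2 + (norm_d d (x' - y))\<^sup>2 - (norm_d d (x - x'))\<^sup>2) / 2"
  using inner_d_polarization[of d x y x' y] by (simp add: norm_d_def L2_set_def)

text \<open>A common format for all five statistics. For \<open>m\<close>, \<open>n\<close> at least
  2 it is a genuine mean over ordered pairs of distinct indices in each sample, so double sums with
  other normalisations become marginal cases and can be compared summand by summand.\<close>

definition quad_avg :: "nat \<Rightarrow> nat \<Rightarrow> (nat \<Rightarrow> nat \<Rightarrow> nat \<Rightarrow> nat \<Rightarrow> real) \<Rightarrow> real" where
  "quad_avg m n f = c_mn m n * (\<Sum>i1 = 1..m. \<Sum>i2\<in>{1..m} - {i1}. \<Sum>j1 = 1..n. \<Sum>j2\<in>{1..n} - {j1}.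
     f i1 i2 j1 j2)"

lemma quad_avg_add: "quad_avg m n (\<lambda>a b c e. f a b c e + g a b c e) = quad_avg m n f + quad_avg m n g"
  by (simp add: quad_avg_def sum.distrib algebra_simps)

lemma quad_avg_diff: "quad_avg m n (\<lambda>a b c e. f a b c e - g a b c e) = quad_avg m n f - quad_avg m n g"
  by (simp add: quad_avg_def sum_subtractf algebra_simps)

lemma quad_avg_mult: "quad_avg m n (\<lambda>a b c e. k * f a b c e) = k * quad_avg m n f"
  by (simp add: quad_avg_def sum_distrib_left mult_ac)

lemma quad_avg_divide: "quad_avg m n (\<lambda>a b c e. f a b c e / k) = quad_avg m n f / k"
  using quad_avg_mult[of m n "1 / k" f] by simp

lemma real_card_remove: "i \<in> {1..m} \<Longrightarrow> real (card ({1..m} - {i::nat})) = real m - 1"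
  by (cases m) auto

lemma quad_avg_xx:
  assumes "2 \<le> n"
  shows "quad_avg m n (\<lambda>i1 i2 j1 j2. f i1 i2)
    = 1 / (real m * (real m - 1)) * (\<Sum>i1 = 1..m. \<Sum>i2\<in>{1..m} - {i1}. f i1 i2)"
proof -
  have "(\<Sum>j1 = 1..n. \<Sum>j2\<in>{1..n} - {j1}. a) = real n * (real n - 1) * a" for a :: real
    by (simp add: real_card_remove)
  then have "quad_avg m n (\<lambda>i1 i2 j1 j2. f i1 i2) =
     c_mn m n * (\<Sum>i1 = 1..m. \<Sum>i2\<in>{1..m} - {i1}. real n * (real n - 1) * f i1 i2)"
    unfolding quad_avg_def by presburger
  also have "\<dots> = c_mn m n * (real n * (real n - 1)) * (\<Sum>i1 = 1..m. \<Sum>i2\<in>{1..m} - {i1}. f i1 i2)"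
    by (simp only: sum_distrib_left[symmetric] mult.assoc)
  also have "c_mn m n * (real n * (real n - 1)) = 1 / (real m * (real m - 1))"
    using assms by (simp add: c_mn_def)
  finally show ?thesis .
qed

lemma quad_avg_yy:
  assumes "2 \<le> m"
  shows "quad_avg m n (\<lambda>i1 i2 j1 j2. f j1 j2)
    = 1 / (real n * (real n - 1)) * (\<Sum>j1 = 1..n. \<Sum>j2\<in>{1..n} - {j1}. f j1 j2)"
proof -
  have "(\<Sum>i1 = 1..m. \<Sum>i2\<in>{1..m} - {i1}. a) = real m * (real m - 1) * a" for a :: real
    by (simp add: real_card_remove)
  then have "quad_avg m n (\<lambda>i1 i2 j1 j2. f j1 j2) =
     c_mn m n * (real m * (real m - 1) * (\<Sum>j1 = 1..n. \<Sum>j2\<in>{1..n} - {j1}. f j1 j2))"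
    unfolding quad_avg_def by presburger
  also have "\<dots> = c_mn m n * (real m * (real m - 1)) * (\<Sum>j1 = 1..n. \<Sum>j2\<in>{1..n} - {j1}. f j1 j2)"
    by simp
  also have "c_mn m n * (real m * (real m - 1)) = 1 / (real n * (real n - 1))"
    using assms by (simp add: c_mn_def)
  finally show ?thesis .
qed

lemma sum_remove_swap:
  fixes f :: "nat \<Rightarrow> nat \<Rightarrow> real"
  assumes "finite A"
  shows "(\<Sum>i\<in>A. \<Sum>i'\<in>A - {i}. f i i') = (\<Sum>i\<in>A. \<Sum>i'\<in>A - {i}. f i' i)"
proof -
  have eq: "A - {i} = {i' \<in> A. i' \<noteq> i}" for i by auto
  show ?thesis unfolding eq using sum.swap_restrict[OF assms assms, of f "\<lambda>i i'. i' \<noteq> i"]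
    by (simp add: eq_commute cong: conj_cong)
qed

lemma quad_avg_swap_x: "quad_avg m n (\<lambda>i1 i2 j1 j2. f i2 i1 j1 j2) = quad_avg m n f"
  unfolding quad_avg_def by (subst sum_remove_swap) auto

lemma quad_avg_swap_y: "quad_avg m n (\<lambda>i1 i2 j1 j2. f i1 i2 j2 j1) = quad_avg m n f"
proof -
  have "(\<Sum>j1 = 1..n. \<Sum>j2\<in>{1..n} - {j1}. f i1 i2 j2 j1)
     = (\<Sum>j1 = 1..n. \<Sum>j2\<in>{1..n} - {j1}. f i1 i2 j1 j2)" for i1 i2
    by (subst sum_remove_swap) auto
  then show ?thesis unfolding quad_avg_def by presburger
qed

lemma quad_avg_xy:
  assumes "2 \<le> m" "2 \<le> n"
  shows "quad_avg m n (\<lambda>i1 i2 j1 j2. f i1 j1)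
    = 1 / (real m * real n) * (\<Sum>i = 1..m. \<Sum>j = 1..n. f i j)"
proof -
  have "quad_avg m n (\<lambda>i1 i2 j1 j2. f i1 j1) =
     c_mn m n * (\<Sum>i1 = 1..m. (real m - 1) * (\<Sum>j1 = 1..n. (real n - 1) * f i1 j1))"
    unfolding quad_avg_def
    by (intro arg_cong[where f="(*) (c_mn m n)"] sum.cong refl) (simp add: real_card_remove)
  also have "\<dots> = c_mn m n * ((real m - 1) * (real n - 1)) * (\<Sum>i1 = 1..m. \<Sum>j1 = 1..n. f i1 j1)"
    by (simp only: sum_distrib_left[symmetric] mult.assoc)
  also have "c_mn m n * ((real m - 1) * (real n - 1)) = 1 / (real m * real n)"
    using assms by (simp add: c_mn_def)
  finally show ?thesis .
qed

text \<open>Relabelling within a sample leaves the mean unchanged, so all placements of a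
  cross-sample term may be identified.\<close>

lemma quad_avg_xy_other:
  "quad_avg m n (\<lambda>i1 i2 j1 j2. f i2 j1) = quad_avg m n (\<lambda>i1 i2 j1 j2. f i1 j1)"
  "quad_avg m n (\<lambda>i1 i2 j1 j2. f i1 j2) = quad_avg m n (\<lambda>i1 i2 j1 j2. f i1 j1)"
  using quad_avg_swap_x[of m n "\<lambda>i1 i2 j1 j2. f i1 j1"] quad_avg_swap_y[of m n "\<lambda>i1 i2 j1 j2. f i1 j1"]
  by simp_all

lemma quad_avg_bound:
  assumes "2 \<le> m" "2 \<le> n"
    and "\<And>i1 i2 j1 j2. i1 \<in> {1..m} \<Longrightarrow> i2 \<in> {1..m} \<Longrightarrow> i1 \<noteq> i2 \<Longrightarrow> j1 \<in> {1..n} \<Longrightarrow> j2 \<in> {1..n} \<Longrightarrow> j1 \<noteq> j2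
      \<Longrightarrow> \<bar>f i1 i2 j1 j2\<bar> \<le> B"
  shows "\<bar>quad_avg m n f\<bar> \<le> B"
proof -
  have c: "0 \<le> c_mn m n" using assms(1,2) by (simp add: c_mn_def)
  have "\<bar>quad_avg m n f\<bar> \<le> quad_avg m n (\<lambda>_ _ _ _. B)"
    unfolding quad_avg_def abs_mult abs_of_nonneg[OF c]
    by (intro mult_left_mono c order_trans[OF sum_abs] sum_mono) (use assms(3) in auto)
  \<comment> \<open>The weights sum to 1: this is the cross-sample marginal of a constant.\<close>
  also have "\<dots> = B" using assms(1,2) by (simp add: quad_avg_xy)
  finally show ?thesis .
qed

lemma U_CQ_quad_avg: "U_CQ d m n x y = quad_avg m n (\<lambda>i1 i2 j1 j2. inner_d d (x i1 - y j1) (x i2 - y j2))"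
  by (simp add: U_CQ_def quad_avg_def)

text \<open>Distances between the two samples are symmetrised so that the summand matches the linear part
  of the sum of the two angles in the CvM statistic.\<close>

lemma U_CQ_angles:
  "U_CQ d m n x y = quad_avg m n (\<lambda>i1 i2 j1 j2.
     ((norm_d d (x i1 - y j1))\<^sup>2 + (norm_d d (x i2 - y j1))\<^sup>2) / 4 - (norm_d d (x i1 - x i2))\<^sup>2 / 2
   + (((norm_d d (y j1 - x i1))\<^sup>2 + (norm_d d (y j2 - x i1))\<^sup>2) / 4 - (norm_d d (y j1 - y j2))\<^sup>2 / 2))"
proof -
  let ?D = "\<lambda>u v. (norm_d d (u - v))\<^sup>2"
  note Q = quad_avg_add quad_avg_diff quad_avg_divide
  have *: "?D (y j) (x i) = ?D (x i) (y j)" for i j by (simp add: norm_d_minus_commute)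
  show ?thesis
    unfolding U_CQ_quad_avg inner_d_polarization *
    by (simp only: Q quad_avg_xy_other[where f="\<lambda>i j. ?D (x i) (y j)"]) (simp add: field_simps)
qed

section \<open>Deterministic expansions of the statistics for nearly equal distances\<close>

text \<open>The tolerance \<open>e\<close> is absolute so that it can be read relative to
  \<open>s\<close> (as \<open>\<tau> * s\<close>) or relative to the squared bandwidth (as
  \<open>\<eta> * bw\<^sup>2\<close>). Coinciding indices are excluded, since their distance is
  0.\<close>

definition dists_close ::
  "nat \<Rightarrow> nat \<Rightarrow> nat \<Rightarrow> (nat \<Rightarrow> rvec) \<Rightarrow> (nat \<Rightarrow> rvec) \<Rightarrow> real \<Rightarrow> real \<Rightarrow> bool" where
  "dists_close d m n x y s e \<longleftrightarrow>
     (\<forall>i\<in>{1..m}. \<forall>j\<in>{1..n}. \<bar>(norm_d d (x i - y j))\<^sup>2 - s\<bar> \<le> e) \<and>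
     (\<forall>i\<in>{1..m}. \<forall>i'\<in>{1..m} - {i}. \<bar>(norm_d d (x i - x i'))\<^sup>2 - s\<bar> \<le> e) \<and>
     (\<forall>j\<in>{1..n}. \<forall>j'\<in>{1..n} - {j}. \<bar>(norm_d d (y j - y j'))\<^sup>2 - s\<bar> \<le> e)"

lemma dists_closeD:
  assumes "dists_close d m n x y s e"
  shows "i \<in> {1..m} \<Longrightarrow> j \<in> {1..n} \<Longrightarrow> \<bar>(norm_d d (x i - y j))\<^sup>2 - s\<bar> \<le> e"
    and "i \<in> {1..m} \<Longrightarrow> i' \<in> {1..m} \<Longrightarrow> i \<noteq> i' \<Longrightarrow> \<bar>(norm_d d (x i - x i'))\<^sup>2 - s\<bar> \<le> e"
    and "j \<in> {1..n} \<Longrightarrow> j' \<in> {1..n} \<Longrightarrow> j \<noteq> j' \<Longrightarrow> \<bar>(norm_d d (y j - y j'))\<^sup>2 - s\<bar> \<le> e"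
  using assms unfolding dists_close_def by blast+

lemma dists_close_mono: "dists_close d m n x y s e \<Longrightarrow> e \<le> e' \<Longrightarrow> dists_close d m n x y s e'"
  unfolding dists_close_def by (meson order_trans)

text \<open>Serves energy (\<open>f\<close> is the square root) and MMD (\<open>f\<close> is minus
  the kernel profile). The weights 2, -1, -1 annihilate the constant \<open>f0\<close>, and by
  polarisation the linear part is \<open>2 * f1\<close> times the CQ statistic.\<close>

lemma sample_distances_approx:
  assumes "2 \<le> m" "2 \<le> n"
    and f: "\<And>D. \<bar>D - s\<bar> \<le> e \<Longrightarrow> \<bar>f D - f0 - f1 * (D - s)\<bar> \<le> B"
    and close: "dists_close d m n x y s e"
  shows "\<bar>2 / (real m * real n) * (\<Sum>i = 1..m. \<Sum>j = 1..n. f ((norm_d d (x i - y j))\<^sup>2))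
     - 1 / (real m * (real m - 1)) * (\<Sum>i1 = 1..m. \<Sum>i2\<in>{1..m} - {i1}. f ((norm_d d (x i1 - x i2))\<^sup>2))
     - 1 / (real n * (real n - 1)) * (\<Sum>j1 = 1..n. \<Sum>j2\<in>{1..n} - {j1}. f ((norm_d d (y j1 - y j2))\<^sup>2))
     - 2 * f1 * U_CQ d m n x y\<bar> \<le> 4 * B" (is "\<bar>?L\<bar> \<le> _")
proof -
  let ?D = "\<lambda>u v. (norm_d d (u - v))\<^sup>2"
  define r where "r D = f D - f0 - f1 * (D - s)" for D
  note Q = quad_avg_add quad_avg_diff quad_avg_mult quad_avg_divide
  have "?L = quad_avg m n (\<lambda>i1 i2 j1 j2. f (?D (x i1) (y j2)) + f (?D (x i2) (y j1))
      - f (?D (x i1) (x i2)) - f (?D (y j1) (y j2)) - 2 * f1 * inner_d d (x i1 - y j1) (x i2 - y j2))"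
    unfolding U_CQ_quad_avg
    by (simp only: Q quad_avg_xy_other[where f="\<lambda>i j. f (?D (x i) (y j))"] quad_avg_xy[OF assms(1,2)]
        quad_avg_xx[OF assms(2)] quad_avg_yy[OF assms(1)])
  also have "\<dots> = quad_avg m n (\<lambda>i1 i2 j1 j2. r (?D (x i1) (y j2)) + r (?D (x i2) (y j1))
      - r (?D (x i1) (x i2)) - r (?D (y j1) (y j2)))"
    \<comment> \<open>Four distances remain in each summand, two across and two within the samples;
      hence the factor 4 in the bound.\<close>
    unfolding inner_d_polarization r_def
    by (intro arg_cong[where f="quad_avg m n"] ext) (simp add: field_simps)
  also have "\<bar>\<dots>\<bar> \<le> 4 * B"
  proof (rule quad_avg_bound[OF assms(1,2)])
    fix i1 i2 j1 j2
    assume *: "i1 \<in> {1..m}" "i2 \<in> {1..m}" "i1 \<noteq> i2" "j1 \<in> {1..n}" "j2 \<in> {1..n}" "j1 \<noteq> j2"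
    have "\<bar>r (?D (x i1) (y j2))\<bar> \<le> B" "\<bar>r (?D (x i2) (y j1))\<bar> \<le> B"
      "\<bar>r (?D (x i1) (x i2))\<bar> \<le> B" "\<bar>r (?D (y j1) (y j2))\<bar> \<le> B"
      unfolding r_def using * by (auto intro!: f dists_closeD[OF close])
    then show "\<bar>r (?D (x i1) (y j2)) + r (?D (x i2) (y j1))
      - r (?D (x i1) (x i2)) - r (?D (y j1) (y j2))\<bar> \<le> 4 * B" by linarith
  qed
  finally show ?thesis .
qed

lemma U_Energy_approx:
  assumes "2 \<le> m" "2 \<le> n" "0 < s" "\<tau> \<le> 1"
    and close: "dists_close d m n x y s (\<tau> * s)"
  shows "\<bar>U_Energy d m n x y - 1 / sqrt s * U_CQ d m n x y\<bar> \<le> 2 * (sqrt s * \<tau>\<^sup>2)"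
proof -
  have "\<bar>sqrt D - sqrt s - 1 / (2 * sqrt s) * (D - s)\<bar> \<le> sqrt s * \<tau>\<^sup>2 / 2" if "\<bar>D - s\<bar> \<le> \<tau> * s" for D
    using sqrt_dist_approx[OF assms(3,4) that] by simp
  from sample_distances_approx[where x=x and y=y and d=d, OF assms(1,2) this close]
  show ?thesis by (simp add: U_Energy_def norm_d_eq_sqrt[symmetric])
qed

lemma U_MMD_approx:
  assumes "2 \<le> m" "2 \<le> n" "0 < s" "0 < bw\<^sup>2" "\<eta> \<le> 1"
    and close: "dists_close d m n x y s (\<eta> * bw\<^sup>2)"
  shows "\<bar>U_MMD d bw m n x y - exp (- s / (2 * bw\<^sup>2)) / bw\<^sup>2 * U_CQ d m n x y\<bar> \<le> 12 * \<eta>\<^sup>2"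
proof -
  define k where "k = exp (- s / (2 * bw\<^sup>2))"
  \<comment> \<open>The sign is reversed because MMD adds the within-sample kernels and subtracts
    the cross-sample ones.\<close>
  have "\<bar>- exp (- D / (2 * bw\<^sup>2)) - (- k) - k / (2 * bw\<^sup>2) * (D - s)\<bar> \<le> 3 * \<eta>\<^sup>2"
    if "\<bar>D - s\<bar> \<le> \<eta> * bw\<^sup>2" for D
  proof -
    have "\<bar>D - s\<bar> / bw\<^sup>2 \<le> \<eta>" using that assms(4) by (simp add: divide_le_eq)
    from gauss_dist_approx[OF assms(4,3) this assms(5)] show ?thesis
      unfolding k_def[symmetric] by (simp add: abs_le_iff)
  qed
  from sample_distances_approx[where x=x and y=y and d=d, OF assms(1,2) this close]
  show ?thesis unfolding U_MMD_def gauss_kernel_def k_def[symmetric]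
    by (simp add: sum_negf abs_le_iff)
qed

lemma U_WMW_approx:
  assumes "2 \<le> m" "2 \<le> n" "0 < s" "\<tau> \<le> 1 / 16"
    and close: "dists_close d m n x y s (\<tau> * s)"
  shows "\<bar>U_WMW d m n x y - 1 / s * U_CQ d m n x y\<bar> \<le> 4 * \<tau>\<^sup>2"
proof -
  let ?D = "\<lambda>u v. (norm_d d (u - v))\<^sup>2"
  let ?I = "\<lambda>i1 i2 j1 j2. inner_d d (x i1 - y j1) (x i2 - y j2)"
  have "U_WMW d m n x y - 1 / s * U_CQ d m n x y = quad_avg m n (\<lambda>i1 i2 j1 j2.
      ?I i1 i2 j1 j2 / (norm_d d (x i1 - y j1) * norm_d d (x i2 - y j2)) - 1 / s * ?I i1 i2 j1 j2)"
    unfolding quad_avg_diff quad_avg_mult U_CQ_quad_avg by (simp add: U_WMW_def quad_avg_def)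
  also have "\<bar>\<dots>\<bar> \<le> 4 * \<tau>\<^sup>2"
  proof (rule quad_avg_bound[OF assms(1,2)])
    fix i1 i2 j1 j2
    assume *: "i1 \<in> {1..m}" "i2 \<in> {1..m}" "i1 \<noteq> i2" "j1 \<in> {1..n}" "j2 \<in> {1..n}" "j1 \<noteq> j2"
    have "\<bar>((?D (x i1) (y j2) + ?D (x i2) (y j1) - ?D (x i1) (x i2) - ?D (y j1) (y j2)) / 2)
        / (sqrt (?D (x i1) (y j1)) * sqrt (?D (x i2) (y j2)))
      - ((?D (x i1) (y j2) + ?D (x i2) (y j1) - ?D (x i1) (x i2) - ?D (y j1) (y j2)) / 2) / s\<bar> \<le> 4 * \<tau>\<^sup>2"
      by (rule spatial_sign_approx[OF assms(3,4)]) (use * dists_closeD[OF close] in blast)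
    then show "\<bar>?I i1 i2 j1 j2 / (norm_d d (x i1 - y j1) * norm_d d (x i2 - y j2)) - 1 / s * ?I i1 i2 j1 j2\<bar>
      \<le> 4 * \<tau>\<^sup>2"
      unfolding inner_d_polarization norm_d_eq_sqrt[symmetric] by simp
  qed
  finally show ?thesis .
qed

lemma Ang_approx:
  assumes "0 < s" "\<tau> \<le> 1 / 16"
    and "\<bar>(norm_d d (u - w))\<^sup>2 - s\<bar> \<le> \<tau> * s" "\<bar>(norm_d d (v - w))\<^sup>2 - s\<bar> \<le> \<tau> * s"
      "\<bar>(norm_d d (u - v))\<^sup>2 - s\<bar> \<le> \<tau> * s"
  shows "\<bar>Ang d (u - w) (v - w) - pi / 3 + 2 / sqrt 3 *
    ((((norm_d d (u - w))\<^sup>2 + (norm_d d (v - w))\<^sup>2) / 4 - (norm_d d (u - v))\<^sup>2 / 2) / s)\<bar> \<le> 40 * \<tau>\<^sup>2"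
  using angle_approx[OF assms(1,2), of "(norm_d d (u - w))\<^sup>2" "(norm_d d (v - w))\<^sup>2" "(norm_d d (u - v))\<^sup>2"]
    assms(3-5)
  unfolding Ang_def inner_d_common_point norm_d_eq_sqrt[symmetric] by auto

text \<open>Each angle is \<open>pi / 3\<close> minus \<open>2 / sqrt 3\<close> times its linear
  part; the weight \<open>1 / (2 * pi)\<close> turns that slope into
  \<open>1 / (pi * sqrt 3)\<close>, and the constants cancel.\<close>

lemma U_CvM_approx:
  assumes "2 \<le> m" "2 \<le> n" "0 < s" "\<tau> \<le> 1 / 16"
    and close: "dists_close d m n x y s (\<tau> * s)"
  shows "\<bar>U_CvM d m n x y - 1 / (pi * sqrt 3 * s) * U_CQ d m n x y\<bar> \<le> 40 * \<tau>\<^sup>2"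
proof -
  let ?D = "\<lambda>u v. (norm_d d (u - v))\<^sup>2"
  let ?l = "\<lambda>u v w. (?D u w + ?D v w) / 4 - ?D u v / 2"
  let ?A = "\<lambda>u v w. Ang d (u - w) (v - w)"
  have "U_CvM d m n x y - 1 / (pi * sqrt 3 * s) * U_CQ d m n x y = quad_avg m n (\<lambda>i1 i2 j1 j2.
      (1 / 3 - 1 / (2 * pi) * ?A (x i1) (x i2) (y j1) - 1 / (2 * pi) * ?A (y j1) (y j2) (x i1))
      - 1 / (pi * sqrt 3 * s) * (?l (x i1) (x i2) (y j1) + ?l (y j1) (y j2) (x i1)))"
    unfolding quad_avg_diff[where g = "\<lambda>i1 i2 j1 j2. 1 / (pi * sqrt 3 * s) * g i1 i2 j1 j2" for g]
      quad_avg_mult U_CQ_angles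
    by (simp add: U_CvM_def quad_avg_def)
  also have "\<bar>\<dots>\<bar> \<le> 40 * \<tau>\<^sup>2"
  proof (rule quad_avg_bound[OF assms(1,2)])
    fix i1 i2 j1 j2
    assume *: "i1 \<in> {1..m}" "i2 \<in> {1..m}" "i1 \<noteq> i2" "j1 \<in> {1..n}" "j2 \<in> {1..n}" "j1 \<noteq> j2"
    define A1 A2 where "A1 = ?A (x i1) (x i2) (y j1)" and "A2 = ?A (y j1) (y j2) (x i1)"
    define l1 l2 where "l1 = ?l (x i1) (x i2) (y j1) / s" and "l2 = ?l (y j1) (y j2) (x i1) / s"
    define r1 r2 where "r1 = A1 - pi / 3 + 2 / sqrt 3 * l1" and "r2 = A2 - pi / 3 + 2 / sqrt 3 * l2"
    have yx: "\<bar>?D (y j) (x i) - s\<bar> \<le> \<tau> * s" if "i \<in> {1..m}" "j \<in> {1..n}" for i j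
      using dists_closeD(1)[OF close that] by (simp add: norm_d_minus_commute)
    have r: "\<bar>r1\<bar> \<le> 40 * \<tau>\<^sup>2" "\<bar>r2\<bar> \<le> 40 * \<tau>\<^sup>2"
      unfolding r1_def r2_def A1_def A2_def l1_def l2_def
      by (rule Ang_approx[OF assms(3,4)]; use * yx dists_closeD[OF close] in blast)+
    \<comment> \<open>Stated for an arbitrary \<open>k\<close> so that the field arithmetic does not
      meet \<open>sqrt 3\<close>.\<close>
    have "1 / 3 - 1 / (2 * pi) * A1 - 1 / (2 * pi) * A2 - k / pi * (l1 + l2)
      = - (1 / (2 * pi)) * ((A1 - pi / 3 + 2 * k * l1) + (A2 - pi / 3 + 2 * k * l2))" for k
      by (simp add: field_simps)
    from this[of "1 / sqrt 3"]
    have "1 / 3 - 1 / (2 * pi) * A1 - 1 / (2 * pi) * A2 - 1 / (pi * sqrt 3) * (l1 + l2)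
      = - (1 / (2 * pi)) * (r1 + r2)"
      unfolding r1_def r2_def by (simp add: mult.commute)
    also have "\<bar>\<dots>\<bar> \<le> 1 / 2 * (80 * \<tau>\<^sup>2)"
      unfolding abs_mult using r pi_ge_two by (intro mult_mono) (auto simp: field_simps)
    finally show "\<bar>1 / 3 - 1 / (2 * pi) * ?A (x i1) (x i2) (y j1) - 1 / (2 * pi) * ?A (y j1) (y j2) (x i1)
      - 1 / (pi * sqrt 3 * s) * (?l (x i1) (x i2) (y j1) + ?l (y j1) (y j2) (x i1))\<bar> \<le> 40 * \<tau>\<^sup>2"
      unfolding A1_def[symmetric] A2_def[symmetric]
      by (simp add: l1_def l2_def add_divide_distrib mult.commute)
  qed
  finally show ?thesis .
qed

subsection \<open>Stochastic orders\<close>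

lemma norm_d_diff_measurable:
  assumes "u \<in> measurable M (Rd d)" "v \<in> measurable M (Rd d)"
  shows "(\<lambda>\<omega>. norm_d d (u \<omega> - v \<omega>)) \<in> borel_measurable M"
    and "u' \<in> measurable M (Rd d) \<Longrightarrow> v' \<in> measurable M (Rd d) \<Longrightarrow>
      (\<lambda>\<omega>. inner_d d (u \<omega> - v \<omega>) (u' \<omega> - v' \<omega>)) \<in> borel_measurable M"
proof -
  have *: "(\<lambda>\<omega>. w \<omega> i) \<in> borel_measurable M" if "w \<in> measurable M (Rd d)" "i < d" for w i
    using measurable_component_singleton[of i "{..<d}" "\<lambda>_. borel"] that
    unfolding Rd_def by (auto intro: measurable_compose)
  show "(\<lambda>\<omega>. norm_d d (u \<omega> - v \<omega>)) \<in> borel_measurable M"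
    unfolding norm_d_def L2_set_def fun_diff_def
    by (intro measurable_compose[OF _ borel_measurable_sqrt] borel_measurable_sum borel_measurable_power borel_measurable_diff
        *[OF assms(1)] *[OF assms(2)]) auto
  show "(\<lambda>\<omega>. inner_d d (u \<omega> - v \<omega>) (u' \<omega> - v' \<omega>)) \<in> borel_measurable M"
    if "u' \<in> measurable M (Rd d)" "v' \<in> measurable M (Rd d)"
    unfolding inner_d_def fun_diff_def
    by (intro borel_measurable_sum borel_measurable_times borel_measurable_diff
        *[OF assms(1)] *[OF assms(2)] *[OF that(1)] *[OF that(2)]) auto
qed

lemma abs_cosine_le_1: "\<bar>inner_d d u v / (norm_d d u * norm_d d v)\<bar> \<le> 1"
proof -
  have "\<bar>inner_d d u v\<bar> \<le> (\<Sum>i<d. \<bar>u i\<bar> * \<bar>v i\<bar>)"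
    unfolding inner_d_def by (rule order_trans[OF sum_abs]) (simp add: abs_mult)
  also have "\<dots> \<le> norm_d d u * norm_d d v" unfolding norm_d_def by (rule L2_set_mult_ineq)
  finally show ?thesis
    by (cases "norm_d d u * norm_d d v = 0") (auto simp: abs_mult divide_le_eq)
qed

text \<open>\<open>arccos\<close> is specified only on [-1, 1]. By Cauchy-Schwarz the argument may
  be clamped to that interval without changing the value, and the clamped function is continuous on
  the whole line.\<close>

lemma Ang_measurable:
  assumes "u \<in> measurable M (Rd d)" "v \<in> measurable M (Rd d)" "w \<in> measurable M (Rd d)"
  shows "(\<lambda>\<omega>. Ang d (u \<omega> - w \<omega>) (v \<omega> - w \<omega>)) \<in> borel_measurable M"
proof -
  have eq: "Ang d x y = arccos (max (- 1) (min 1 (inner_d d x y / (norm_d d x * norm_d d y))))" for x y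
  proof -
    define c where "c = inner_d d x y / (norm_d d x * norm_d d y)"
    have "\<bar>c\<bar> \<le> 1" unfolding c_def by (rule abs_cosine_le_1)
    then have "max (- 1) (min 1 c) = c" by (simp add: abs_le_iff)
    then show ?thesis by (simp add: Ang_def c_def)
  qed
  have "continuous_on UNIV (\<lambda>x::real. arccos (max (- 1) (min 1 x)))"
    by (intro continuous_on_arccos continuous_intros) auto
  then have "(\<lambda>x::real. arccos (max (- 1) (min 1 x))) \<in> borel_measurable borel"
    by (rule borel_measurable_continuous_onI)
  from measurable_compose[OF _ this] show ?thesis unfolding eq
    by this (intro borel_measurable_divide borel_measurable_times norm_d_diff_measurable assms)
qed

lemma statistics_measurable:
  assumes "\<And>i. i \<in> {1..m} \<Longrightarrow> x i \<in> measurable M (Rd d)"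
    and "\<And>j. j \<in> {1..n} \<Longrightarrow> y j \<in> measurable M (Rd d)"
  shows "(\<lambda>\<omega>. U_CvM d m n (\<lambda>i. x i \<omega>) (\<lambda>j. y j \<omega>)) \<in> borel_measurable M"
    and "(\<lambda>\<omega>. U_CQ d m n (\<lambda>i. x i \<omega>) (\<lambda>j. y j \<omega>)) \<in> borel_measurable M"
    and "(\<lambda>\<omega>. U_WMW d m n (\<lambda>i. x i \<omega>) (\<lambda>j. y j \<omega>)) \<in> borel_measurable M"
    and "(\<lambda>\<omega>. U_Energy d m n (\<lambda>i. x i \<omega>) (\<lambda>j. y j \<omega>)) \<in> borel_measurable M"
    and "(\<lambda>\<omega>. U_MMD d bw m n (\<lambda>i. x i \<omega>) (\<lambda>j. y j \<omega>)) \<in> borel_measurable M"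
proof -
  note arith = borel_measurable_sum borel_measurable_times borel_measurable_divide borel_measurable_diff
    borel_measurable_add borel_measurable_const
  show "(\<lambda>\<omega>. U_CvM d m n (\<lambda>i. x i \<omega>) (\<lambda>j. y j \<omega>)) \<in> borel_measurable M"
    unfolding U_CvM_def by (intro arith Ang_measurable) (simp_all add: assms)
  show "(\<lambda>\<omega>. U_CQ d m n (\<lambda>i. x i \<omega>) (\<lambda>j. y j \<omega>)) \<in> borel_measurable M"
    unfolding U_CQ_def by (intro arith norm_d_diff_measurable) (simp_all add: assms)
  show "(\<lambda>\<omega>. U_WMW d m n (\<lambda>i. x i \<omega>) (\<lambda>j. y j \<omega>)) \<in> borel_measurable M"
    unfolding U_WMW_def by (intro arith norm_d_diff_measurable) (simp_all add: assms)
  show "(\<lambda>\<omega>. U_Energy d m n (\<lambda>i. x i \<omega>) (\<lambda>j. y j \<omega>)) \<in> borel_measurable M"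
    unfolding U_Energy_def by (intro arith norm_d_diff_measurable) (simp_all add: assms)
  have "(\<lambda>\<omega>. gauss_kernel d bw (u \<omega>) (v \<omega>)) \<in> borel_measurable M"
    if [measurable]: "u \<in> measurable M (Rd d)" "v \<in> measurable M (Rd d)" for u v
  proof -
    note [measurable] = norm_d_diff_measurable(1)[OF that]
    show ?thesis unfolding gauss_kernel_def by measurable
  qed
  then show "(\<lambda>\<omega>. U_MMD d bw m n (\<lambda>i. x i \<omega>) (\<lambda>j. y j \<omega>)) \<in> borel_measurable M"
    unfolding U_MMD_def by (intro arith) (simp_all add: assms)
qed

text \<open>The passage from deterministic bounds to stochastic orders: a union bound over the
  finite set \<open>I\<close> controls all \<open>e p\<close> at once. The constant \<open>C\<close>
  may depend on \<open>K\<close>, but not on \<open>d\<close> or on the sample point.\<close>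

lemma bigo_prob_dominated:
  assumes "finite I" and prob: "\<forall>\<^sub>F d in sequentially. prob_space (M d)"
    and e: "\<And>p. p \<in> I \<Longrightarrow> bigo_prob M (e p) r"
    and meas: "\<forall>\<^sub>F d in sequentially. R d \<in> borel_measurable (M d)"
    and dom: "\<And>K. K > 0 \<Longrightarrow> \<exists>C>0. \<forall>\<^sub>F d in sequentially. \<forall>\<omega>\<in>space (M d).
      (\<forall>p\<in>I. \<bar>e p d \<omega>\<bar> \<le> K * \<bar>r d\<bar>) \<longrightarrow> \<bar>R d \<omega>\<bar> \<le> C * \<bar>r' d\<bar>"
  shows "bigo_prob M R r'"
  unfolding bigo_prob_def
proof (intro conjI meas allI impI)
  fix \<epsilon> :: real assume \<epsilon>: "\<epsilon> > 0"
  \<comment> \<open>The added 1 makes the sum of all failure bounds strictly smaller than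
    \<open>\<epsilon>\<close> and covers empty \<open>I\<close>.\<close>
  define \<epsilon>' where "\<epsilon>' = \<epsilon> / (real (card I) + 1)"
  have \<epsilon>': "\<epsilon>' > 0" using \<epsilon> by (simp add: \<epsilon>'_def)
  have "\<forall>p\<in>I. \<exists>C>0. \<forall>\<^sub>F d in sequentially. measure (M d) {\<omega> \<in> space (M d). \<bar>e p d \<omega>\<bar> > C * \<bar>r d\<bar>} < \<epsilon>'"
    using e \<epsilon>' unfolding bigo_prob_def by blast
  then obtain c where c: "\<And>p. p \<in> I \<Longrightarrow> c p > 0"
    "\<And>p. p \<in> I \<Longrightarrow> \<forall>\<^sub>F d in sequentially. measure (M d) {\<omega> \<in> space (M d). \<bar>e p d \<omega>\<bar> > c p * \<bar>r d\<bar>} < \<epsilon>'"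
    using bchoice[of I "\<lambda>p C. C > 0 \<and> (\<forall>\<^sub>F d in sequentially.
      measure (M d) {\<omega> \<in> space (M d). \<bar>e p d \<omega>\<bar> > C * \<bar>r d\<bar>} < \<epsilon>')"] by blast
  define K where "K = 1 + (\<Sum>p\<in>I. c p)"
  have K: "c p \<le> K" if "p \<in> I" for p
  proof -
    have "c p \<le> (\<Sum>p\<in>I. c p)"
      using c(1) that \<open>finite I\<close> by (intro member_le_sum) (auto intro: less_imp_le)
    then show ?thesis by (simp add: K_def)
  qed
  have "K > 0" unfolding K_def using c(1) by (intro add_pos_nonneg sum_nonneg) (auto intro: less_imp_le)
  from dom[OF this] obtain C where C: "C > 0" "\<forall>\<^sub>F d in sequentially. \<forall>\<omega>\<in>space (M d).
      (\<forall>p\<in>I. \<bar>e p d \<omega>\<bar> \<le> K * \<bar>r d\<bar>) \<longrightarrow> \<bar>R d \<omega>\<bar> \<le> C * \<bar>r' d\<bar>" by blast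
  have ev1: "\<forall>\<^sub>F d in sequentially. \<forall>p\<in>I. measure (M d) {\<omega> \<in> space (M d). \<bar>e p d \<omega>\<bar> > c p * \<bar>r d\<bar>} < \<epsilon>'"
    using c(2) \<open>finite I\<close> by (simp add: eventually_ball_finite)
  have ev2: "\<forall>\<^sub>F d in sequentially. \<forall>p\<in>I. e p d \<in> borel_measurable (M d)"
    using e \<open>finite I\<close> unfolding bigo_prob_def by (simp add: eventually_ball_finite)
  have "\<forall>\<^sub>F d in sequentially. measure (M d) {\<omega> \<in> space (M d). \<bar>R d \<omega>\<bar> > C * \<bar>r' d\<bar>} < \<epsilon>"
    using C(2) ev1 ev2 prob
  proof eventually_elim
    case (elim d)
    interpret prob_space "M d" by (rule elim(4))
    define A where "A p = {\<omega> \<in> space (M d). \<bar>e p d \<omega>\<bar> > c p * \<bar>r d\<bar>}" for p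
    have A: "A p \<in> sets (M d)" if "p \<in> I" for p
    proof -
      have [measurable]: "e p d \<in> borel_measurable (M d)" using elim(3) that by blast
      show ?thesis unfolding A_def by measurable
    qed
    have "{\<omega> \<in> space (M d). \<bar>R d \<omega>\<bar> > C * \<bar>r' d\<bar>} \<subseteq> (\<Union>p\<in>I. A p)"
    proof
      fix \<omega> assume \<omega>: "\<omega> \<in> {\<omega> \<in> space (M d). \<bar>R d \<omega>\<bar> > C * \<bar>r' d\<bar>}"
      then have "\<not> (\<forall>p\<in>I. \<bar>e p d \<omega>\<bar> \<le> K * \<bar>r d\<bar>)" using elim(1) leD by blast
      then obtain p where p: "p \<in> I" "K * \<bar>r d\<bar> < \<bar>e p d \<omega>\<bar>" by (meson not_le)
      have "c p * \<bar>r d\<bar> \<le> K * \<bar>r d\<bar>" using K[OF p(1)] by (intro mult_right_mono) auto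
      then show "\<omega> \<in> (\<Union>p\<in>I. A p)" using p \<omega> by (intro UN_I[OF p(1)]) (simp add: A_def)
    qed
    moreover have "(\<Union>p\<in>I. A p) \<in> events" using A \<open>finite I\<close> by (intro sets.finite_UN) auto
    ultimately have "prob {\<omega> \<in> space (M d). \<bar>R d \<omega>\<bar> > C * \<bar>r' d\<bar>} \<le> prob (\<Union>p\<in>I. A p)"
      by (intro finite_measure_mono) auto
    also have "\<dots> \<le> (\<Sum>p\<in>I. prob (A p))"
      using A \<open>finite I\<close> by (intro finite_measure_subadditive_finite) auto
    also have "\<dots> \<le> (\<Sum>p\<in>I. \<epsilon>')" using elim(2) by (intro sum_mono) (auto simp: A_def less_imp_le)
    also have "\<dots> < \<epsilon>" using \<epsilon> by (simp add: \<epsilon>'_def field_simps)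
    finally show ?case .
  qed
  with C(1) show "\<exists>C>0. \<forall>\<^sub>F d in sequentially. measure (M d) {\<omega> \<in> space (M d). \<bar>R d \<omega>\<bar> > C * \<bar>r' d\<bar>} < \<epsilon>"
    by blast
qed

section \<open>Mean and concentration of squared distances\<close>

lemma (in prob_space) expectation_indep_diff_sq:
  fixes U V :: "'a \<Rightarrow> real"
  assumes indep: "indep_var borel U borel V"
    and U2: "integrable M (\<lambda>\<omega>. (U \<omega>)\<^sup>2)" and V2: "integrable M (\<lambda>\<omega>. (V \<omega>)\<^sup>2)"
  shows "expectation (\<lambda>\<omega>. (U \<omega> - V \<omega>)\<^sup>2) = variance U + variance V + (expectation U - expectation V)\<^sup>2"
    and "integrable M (\<lambda>\<omega>. (U \<omega> - V \<omega>)\<^sup>2)"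
proof -
  have [measurable]: "U \<in> borel_measurable M" "V \<in> borel_measurable M"
    using indep_var_rv1[OF indep] indep_var_rv2[OF indep] by auto
  have [simp]: "integrable M U" "integrable M V"
    using U2 V2 by (auto intro!: square_integrable_imp_integrable)
  note [simp] = U2 V2
  have [simp]: "integrable M (\<lambda>\<omega>. U \<omega> * V \<omega>)" by (rule indep_var_integrable[OF indep]) simp_all
  have UV: "expectation (\<lambda>\<omega>. U \<omega> * V \<omega>) = expectation U * expectation V"
    by (rule indep_var_lebesgue_integral[OF indep]) simp_all
  have eq: "(U \<omega> - V \<omega>)\<^sup>2 = (U \<omega>)\<^sup>2 + (V \<omega>)\<^sup>2 - 2 * (U \<omega> * V \<omega>)" for \<omega>
    by (simp add: power2_eq_square algebra_simps)
  show "integrable M (\<lambda>\<omega>. (U \<omega> - V \<omega>)\<^sup>2)" unfolding eq by simp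
  show "expectation (\<lambda>\<omega>. (U \<omega> - V \<omega>)\<^sup>2) = variance U + variance V + (expectation U - expectation V)\<^sup>2"
    unfolding eq by (simp add: UV variance_eq) (simp add: power2_eq_square algebra_simps)
qed

text \<open>Works coordinate by coordinate. Expectation is additive under any dependence between
  coordinates, so only the diagonal of each covariance matrix appears; independence is used between
  the two vectors.\<close>

lemma (in prob_space) expectation_dist_sq:
  assumes indep: "indep_var (Rd d) A (Rd d) B"
    and A: "\<And>i. i < d \<Longrightarrow> integrable (distr M (Rd d) A) (\<lambda>x. (x i)\<^sup>2)"
    and B: "\<And>i. i < d \<Longrightarrow> integrable (distr M (Rd d) B) (\<lambda>x. (x i)\<^sup>2)"
  shows "expectation (\<lambda>\<omega>. (norm_d d (A \<omega> - B \<omega>))\<^sup>2) =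
    trace_d d (cov_mat (distr M (Rd d) A)) + trace_d d (cov_mat (distr M (Rd d) B))
    + (norm_d d (mean_vec (distr M (Rd d) A) - mean_vec (distr M (Rd d) B)))\<^sup>2"
proof -
  have [measurable]: "A \<in> measurable M (Rd d)" "B \<in> measurable M (Rd d)"
    using indep_var_rv1[OF indep] indep_var_rv2[OF indep] by auto
  have proj: "(\<lambda>x. x i) \<in> borel_measurable (Rd d)" if "i < d" for i
    unfolding Rd_def using measurable_component_singleton[of i "{..<d}" "\<lambda>_. borel"] that by simp
  have mv: "mean_vec (distr M (Rd d) C) i = expectation (\<lambda>\<omega>. C \<omega> i)"
    "cov_mat (distr M (Rd d) C) i i = variance (\<lambda>\<omega>. C \<omega> i)"
    if "C \<in> measurable M (Rd d)" "i < d" for C i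
  proof -
    note [measurable] = that(1) proj[OF that(2)]
    show 1: "mean_vec (distr M (Rd d) C) i = expectation (\<lambda>\<omega>. C \<omega> i)"
      unfolding mean_vec_def by (subst integral_distr) auto
    show "cov_mat (distr M (Rd d) C) i i = variance (\<lambda>\<omega>. C \<omega> i)"
      unfolding cov_mat_def 1 by (subst integral_distr) (auto simp: power2_eq_square)
  qed
  have ind: "indep_var borel (\<lambda>\<omega>. A \<omega> i) borel (\<lambda>\<omega>. B \<omega> i)" if "i < d" for i
    using indep_var_compose[OF indep proj[OF that] proj[OF that]] by (simp add: comp_def)
  have sq: "integrable M (\<lambda>\<omega>. (A \<omega> i)\<^sup>2)" "integrable M (\<lambda>\<omega>. (B \<omega> i)\<^sup>2)" if "i < d" for i
    using A[OF that] B[OF that] proj[OF that] by (auto simp: integrable_distr_eq)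
  note coord = expectation_indep_diff_sq[OF ind sq]
  have "expectation (\<lambda>\<omega>. (norm_d d (A \<omega> - B \<omega>))\<^sup>2) = (\<Sum>i<d. expectation (\<lambda>\<omega>. (A \<omega> i - B \<omega> i)\<^sup>2))"
    unfolding norm_d_sq fun_diff_def using coord(2) by (subst Bochner_Integration.integral_sum) auto
  also have "\<dots> = (\<Sum>i<d. cov_mat (distr M (Rd d) A) i i + cov_mat (distr M (Rd d) B) i i
      + (mean_vec (distr M (Rd d) A) i - mean_vec (distr M (Rd d) B) i)\<^sup>2)"
    by (intro sum.cong refl) (simp add: coord(1) mv)
  finally show ?thesis by (simp add: sum.distrib trace_d_def norm_d_sq)
qed

text \<open>Chebyshev's inequality around the true mean, plus the distance of that mean from
  \<open>s d\<close>; hypothesis \<open>mean\<close> makes this bias O(\<open>sqrt d\<close>), the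
  order of the standard deviation.\<close>

lemma bigo_prob_dist_sq:
  fixes A B :: "nat \<Rightarrow> 'a \<Rightarrow> rvec" and P Q :: "nat \<Rightarrow> rvec measure"
  assumes ev: "\<forall>\<^sub>F d in sequentially. prob_space (M d) \<and>
      prob_space.indep_var (M d) (Rd d) (A d) (Rd d) (B d) \<and>
      distr (M d) (Rd d) (A d) = P d \<and> distr (M d) (Rd d) (B d) = Q d \<and>
      (\<forall>i<d. integrable (P d) (\<lambda>x. (x i)\<^sup>2)) \<and> (\<forall>i<d. integrable (Q d) (\<lambda>x. (x i)\<^sup>2))"
    and var: "variance_bigo (\<lambda>d. P d \<Otimes>\<^sub>M Q d) (\<lambda>d (z1, z2). (norm_d d (z1 - z2))\<^sup>2) (\<lambda>d. real d)"
    and mean: "(\<lambda>d. trace_d d (cov_mat (P d)) + trace_d d (cov_mat (Q d))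
      + (norm_d d (mean_vec (P d) - mean_vec (Q d)))\<^sup>2 - s d) \<in> O(\<lambda>d. sqrt (real d))"
  shows "bigo_prob M (\<lambda>d \<omega>. (norm_d d (A d \<omega> - B d \<omega>))\<^sup>2 - s d) (\<lambda>d. sqrt (real d))"
  unfolding bigo_prob_def
proof (intro conjI allI impI)
  have meas: "A d \<in> measurable (M d) (Rd d)" "B d \<in> measurable (M d) (Rd d)"
    if "prob_space (M d)" "prob_space.indep_var (M d) (Rd d) (A d) (Rd d) (B d)" for d
    using prob_space.indep_var_rv1[OF that] prob_space.indep_var_rv2[OF that] by auto
  show "\<forall>\<^sub>F d in sequentially. (\<lambda>\<omega>. (norm_d d (A d \<omega> - B d \<omega>))\<^sup>2 - s d) \<in> borel_measurable (M d)"
    using ev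
  proof eventually_elim
    case (elim d)
    then show ?case using meas[of d]
      by (intro borel_measurable_diff borel_measurable_power norm_d_diff_measurable) auto
  qed
  fix \<epsilon> :: real assume \<epsilon>: "\<epsilon> > 0"
  let ?f = "\<lambda>d (z1, z2). (norm_d d (z1 - z2 :: rvec))\<^sup>2"
  from var have int: "\<forall>\<^sub>F d in sequentially. integrable (P d \<Otimes>\<^sub>M Q d) (\<lambda>x. (?f d x)\<^sup>2)"
    and bigo: "(\<lambda>d. prob_space.variance (P d \<Otimes>\<^sub>M Q d) (?f d)) \<in> O(\<lambda>d. real d)"
    unfolding variance_bigo_def by auto
  from bigo obtain V where V: "V > 0"
    "\<forall>\<^sub>F d in sequentially. norm (prob_space.variance (P d \<Otimes>\<^sub>M Q d) (?f d)) \<le> V * norm (real d)"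
    by (rule landau_o.bigE)
  from mean obtain C1 where C1: "C1 > 0" "\<forall>\<^sub>F d in sequentially. norm (trace_d d (cov_mat (P d)) + trace_d d (cov_mat (Q d))
      + (norm_d d (mean_vec (P d) - mean_vec (Q d)))\<^sup>2 - s d) \<le> C1 * norm (sqrt (real d))"
    by (rule landau_o.bigE)
  \<comment> \<open>Chosen so that the Chebyshev bound \<open>V * d / (K * sqrt d)\<^sup>2\<close>
    equals \<open>\<epsilon> / 2\<close>.\<close>
  define K where "K = sqrt (2 * V / \<epsilon>)"
  have K: "K > 0" "K\<^sup>2 = 2 * V / \<epsilon>" using V(1) \<epsilon> by (auto simp: K_def)
  have "\<forall>\<^sub>F d in sequentially. measure (M d)
      {\<omega> \<in> space (M d). \<bar>(norm_d d (A d \<omega> - B d \<omega>))\<^sup>2 - s d\<bar> > (C1 + K) * \<bar>sqrt (real d)\<bar>} < \<epsilon>"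
    using ev V(2) C1(2) int eventually_gt_at_top[of 0]
  proof eventually_elim
    case (elim d)
    interpret prob_space "M d" using elim(1) by blast
    have ind: "indep_var (Rd d) (A d) (Rd d) (B d)" using elim(1) by blast
    have [measurable]: "A d \<in> measurable (M d) (Rd d)" "B d \<in> measurable (M d) (Rd d)"
      using elim(1) meas by blast+
    have P: "P d = distr (M d) (Rd d) (A d)" and Q: "Q d = distr (M d) (Rd d) (B d)" using elim(1) by auto
    \<comment> \<open>The variance condition speaks of a product law; independence identifies it
      with the joint law of the pair, which carries its moments over to \<open>M d\<close>.\<close>
    have PQ: "P d \<Otimes>\<^sub>M Q d = distr (M d) (Rd d \<Otimes>\<^sub>M Rd d) (\<lambda>\<omega>. (A d \<omega>, B d \<omega>))"
      unfolding P Q using ind by (simp add: indep_var_distribution_eq)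
    define D where "D \<omega> = (norm_d d (A d \<omega> - B d \<omega>))\<^sup>2" for \<omega>
    have D [measurable]: "D \<in> borel_measurable (M d)"
      unfolding D_def by (intro borel_measurable_power norm_d_diff_measurable) measurable
    have f [measurable]: "?f d \<in> borel_measurable (Rd d \<Otimes>\<^sub>M Rd d)"
      unfolding split_beta by (intro borel_measurable_power norm_d_diff_measurable) measurable
    have "integrable (M d) (\<lambda>\<omega>. (?f d (A d \<omega>, B d \<omega>))\<^sup>2)"
      using elim(4) unfolding PQ by (subst (asm) integrable_distr_eq) auto
    then have D2: "integrable (M d) (\<lambda>\<omega>. (D \<omega>)\<^sup>2)" by (simp add: D_def)
    have ED: "integral\<^sup>L (P d \<Otimes>\<^sub>M Q d) (?f d) = expectation D"
      unfolding PQ by (subst integral_distr) (auto simp: D_def[abs_def])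
    have "prob_space.variance (P d \<Otimes>\<^sub>M Q d) (?f d) = variance D"
      unfolding ED unfolding PQ by (subst integral_distr) (auto simp: D_def[abs_def])
    then have var: "variance D \<le> V * d" using elim(2) by simp
    have "expectation D = trace_d d (cov_mat (P d)) + trace_d d (cov_mat (Q d))
      + (norm_d d (mean_vec (P d) - mean_vec (Q d)))\<^sup>2"
      unfolding D_def[abs_def] P Q using elim(1) by (intro expectation_dist_sq ind) auto
    then have bias: "\<bar>expectation D - s d\<bar> \<le> C1 * sqrt d" using elim(3) by simp
    \<comment> \<open>\<open>C1\<close> pays for the bias and \<open>K\<close> for the random
      deviation.\<close>
    have "prob {\<omega> \<in> space (M d). \<bar>D \<omega> - s d\<bar> > (C1 + K) * \<bar>sqrt (real d)\<bar>}
      \<le> prob {\<omega> \<in> space (M d). \<bar>D \<omega> - expectation D\<bar> \<ge> K * sqrt d}"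
    proof (rule finite_measure_mono)
      show "{\<omega> \<in> space (M d). \<bar>D \<omega> - s d\<bar> > (C1 + K) * \<bar>sqrt (real d)\<bar>}
        \<subseteq> {\<omega> \<in> space (M d). \<bar>D \<omega> - expectation D\<bar> \<ge> K * sqrt d}"
        using bias by (auto simp: algebra_simps)
    qed measurable
    also have "\<dots> \<le> variance D / (K * sqrt d)\<^sup>2"
      using elim(5) K(1) by (intro Chebyshev_inequality D D2) auto
    also have "\<dots> \<le> (V * d) / (K * sqrt d)\<^sup>2" by (intro divide_right_mono var) simp
    also have "\<dots> = \<epsilon> / 2" using elim(5) V(1) \<epsilon> by (simp add: power_mult_distrib K(2) field_simps)
    also have "\<dots> < \<epsilon>" using \<epsilon> by simp
    finally show ?case by (simp add: D_def)
  qed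
  then show "\<exists>C>0. \<forall>\<^sub>F d in sequentially. measure (M d)
      {\<omega> \<in> space (M d). \<bar>(norm_d d (A d \<omega> - B d \<omega>))\<^sup>2 - s d\<bar> > C * \<bar>sqrt (real d)\<bar>} < \<epsilon>"
    using C1(1) K(1) by (intro exI[of _ "C1 + K"]) auto
qed

lemma (in prob_space) indep_vars_imp_indep_var:
  assumes "indep_vars M' X I" "i \<in> I" "j \<in> I" "i \<noteq> j"
  shows "indep_var (M' i) (X i) (M' j) (X j)"
proof -
  have "indep_var (M' i) ((\<lambda>f. f i) \<circ> (\<lambda>\<omega>. restrict (\<lambda>k. X k \<omega>) {i}))
    (M' j) ((\<lambda>f. f j) \<circ> (\<lambda>\<omega>. restrict (\<lambda>k. X k \<omega>) {j}))"
    using assms(2-4) by (intro indep_var_compose[OF indep_var_restrict[OF assms(1)]]) auto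
  then show ?thesis by (simp add: comp_def)
qed

text \<open>Equal covariances make both traces cancel against
  \<open>2 * trace_d d (cov_mat (PX d))\<close> whichever samples the two points come from; what is
  left is a squared mean difference, bounded by (A4).\<close>

lemma pooled_dist_bigo:
  fixes X Y :: "nat \<Rightarrow> nat \<Rightarrow> 'a \<Rightarrow> rvec" and M :: "nat \<Rightarrow> 'a measure"
  assumes PX: "\<And>d. d \<ge> 1 \<Longrightarrow> admissible_law d (PX d)" and PY: "\<And>d. d \<ge> 1 \<Longrightarrow> admissible_law d (PY d)"
    and samples: "\<And>d. d \<ge> 1 \<Longrightarrow> two_samples d m n (PX d) (PY d) (M d) (X d) (Y d)"
    and A1: "condA1 PX PY" and A4: "condA4 PX PY"
    and ab: "a \<in> {1..m + n}" "b \<in> {1..m + n}" "a \<noteq> b"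
  shows "bigo_prob M (\<lambda>d \<omega>. (norm_d d (pooled m (X d) (Y d) a \<omega> - pooled m (X d) (Y d) b \<omega>))\<^sup>2
      - 2 * trace_d d (cov_mat (PX d))) (\<lambda>d. sqrt (real d))"
proof -
  define law where "law k = (if k \<le> m then PX else PY)" for k :: nat
  have law: "law k \<in> {PX, PY}" for k by (simp add: law_def)
  have distr: "distr (M d) (Rd d) (pooled m (X d) (Y d) k) = law k d" if "d \<ge> 1" "k \<in> {1..m + n}" for d k
  proof (cases "k \<le> m")
    case True
    then show ?thesis using samples[OF that(1)] that(2) by (auto simp: two_samples_def pooled_def law_def)
  next
    case False
    then have "k - m \<in> {1..n}" using that(2) by auto
    then show ?thesis using samples[OF that(1)] False by (auto simp: two_samples_def pooled_def law_def)
  qed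
  have adm: "admissible_law d (law k d)" if "d \<ge> 1" for d k
    using PX[OF that] PY[OF that] by (simp add: law_def)
  have trace: "trace_d d (cov_mat (law k d)) = trace_d d (cov_mat (PX d))" if "d \<ge> 1" for d k
    using A4 that unfolding condA4_def trace_d_def law_def by (auto intro!: sum.cong)
  \<comment> \<open>The left side is 0 for two points of the same sample and equals the right side
    otherwise.\<close>
  have mean: "(norm_d d (mean_vec (law a d) - mean_vec (law b d)))\<^sup>2
      \<le> (norm_d d (mean_vec (PX d) - mean_vec (PY d)))\<^sup>2" for d
    using norm_d_minus_commute[of d "mean_vec (PX d)" "mean_vec (PY d)"]
    by (auto simp: law_def norm_d_def L2_set_def)
  show ?thesis
  proof (rule bigo_prob_dist_sq)
    show "\<forall>\<^sub>F d in sequentially. prob_space (M d) \<and>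
      prob_space.indep_var (M d) (Rd d) (pooled m (X d) (Y d) a) (Rd d) (pooled m (X d) (Y d) b) \<and>
      distr (M d) (Rd d) (pooled m (X d) (Y d) a) = law a d \<and>
      distr (M d) (Rd d) (pooled m (X d) (Y d) b) = law b d \<and>
      (\<forall>i<d. integrable (law a d) (\<lambda>x. (x i)\<^sup>2)) \<and> (\<forall>i<d. integrable (law b d) (\<lambda>x. (x i)\<^sup>2))"
      using eventually_ge_at_top[of 1]
    proof eventually_elim
      case (elim d)
      from samples[OF elim] have M: "prob_space (M d)"
        and indep: "prob_space.indep_vars (M d) (\<lambda>_. Rd d) (pooled m (X d) (Y d)) {1..m + n}"
        by (auto simp: two_samples_def)
      note prob_space.indep_vars_imp_indep_var[OF M indep ab]
      with M show ?case
        using distr[OF elim ab(1)] distr[OF elim ab(2)] adm[OF elim, of a] adm[OF elim, of b]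
        by (auto simp: admissible_law_def)
    qed
    show "variance_bigo (\<lambda>d. law a d \<Otimes>\<^sub>M law b d) (\<lambda>d (z1, z2). (norm_d d (z1 - z2))\<^sup>2) (\<lambda>d. real d)"
      using A1 law[of a] law[of b] unfolding condA1_def by blast
    have "(\<lambda>d. trace_d d (cov_mat (law a d)) + trace_d d (cov_mat (law b d))
        + (norm_d d (mean_vec (law a d) - mean_vec (law b d)))\<^sup>2 - 2 * trace_d d (cov_mat (PX d)))
      \<in> O(\<lambda>d. (norm_d d (mean_vec (PX d) - mean_vec (PY d)))\<^sup>2)"
      using eventually_ge_at_top[of 1]
      by (intro bigoI[where c=1], eventually_elim) (simp add: trace mean)
    also have "(\<lambda>d. (norm_d d (mean_vec (PX d) - mean_vec (PY d)))\<^sup>2) \<in> O(\<lambda>d. sqrt (real d))"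
      using A4 by (simp add: condA4_def)
    finally show "(\<lambda>d. trace_d d (cov_mat (law a d)) + trace_d d (cov_mat (law b d))
        + (norm_d d (mean_vec (law a d) - mean_vec (law b d)))\<^sup>2 - 2 * trace_d d (cov_mat (PX d)))
      \<in> O(\<lambda>d. sqrt (real d))" .
  qed
qed

section \<open>The four stochastic expansions\<close>

theorem theorem5p2:
  fixes m n :: nat
    and PX PY :: "nat \<Rightarrow> (nat \<Rightarrow> real) measure"
    and M :: "nat \<Rightarrow> 'a measure"
    and X Y :: "nat \<Rightarrow> nat \<Rightarrow> 'a \<Rightarrow> (nat \<Rightarrow> real)"
    and \<sigma>X2 \<sigma>Y2 \<delta>2 :: real
    and bw :: "nat \<Rightarrow> real"
    and \<rho> :: "nat \<Rightarrow> nat"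
  assumes "m \<ge> 2" and "n \<ge> 2"
    and "\<And>d. d \<ge> 1 \<Longrightarrow> admissible_law d (PX d)"
    and "\<And>d. d \<ge> 1 \<Longrightarrow> admissible_law d (PY d)"
    and "\<And>d. d \<ge> 1 \<Longrightarrow> two_samples d m n (PX d) (PY d) (M d) (X d) (Y d)"
    and "condA1 PX PY"
    and "condA2 PX PY \<sigma>X2 \<sigma>Y2 \<delta>2"
    and "condA3 PX PY"
    and "condA4 PX PY"
    and "\<rho> permutes {1..m + n}"
    and "same_order (\<lambda>d. (bw d)\<^sup>2) (\<lambda>d. real d)"
  shows
    "bigo_prob M
       (\<lambda>d \<omega>. sqrt (real d) * permuted (U_CvM d m n) m \<rho> (pooled m (X d) (Y d)) \<omega>
          - 1 / (2 * pi * sqrt (3 * real d) * sigma2_d d (PX d))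
            * permuted (U_CQ d m n) m \<rho> (pooled m (X d) (Y d)) \<omega>)
       (\<lambda>d. 1 / sqrt (real d))
     \<and> bigo_prob M
       (\<lambda>d \<omega>. permuted (U_Energy d m n) m \<rho> (pooled m (X d) (Y d)) \<omega>
          - 1 / (sqrt (2 * real d) * sqrt (sigma2_d d (PX d)))
            * permuted (U_CQ d m n) m \<rho> (pooled m (X d) (Y d)) \<omega>)
       (\<lambda>d. 1 / sqrt (real d))
     \<and> bigo_prob M
       (\<lambda>d \<omega>. sqrt (real d) * permuted (U_WMW d m n) m \<rho> (pooled m (X d) (Y d)) \<omega>
          - 1 / (2 * sqrt (real d) * sigma2_d d (PX d))
            * permuted (U_CQ d m n) m \<rho> (pooled m (X d) (Y d)) \<omega>)
       (\<lambda>d. 1 / sqrt (real d))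
     \<and> bigo_prob M
       (\<lambda>d \<omega>. sqrt (real d) * permuted (U_MMD d (bw d) m n) m \<rho> (pooled m (X d) (Y d)) \<omega>
          - sqrt (real d) / (bw d)\<^sup>2 * exp (- (real d * sigma2_d d (PX d)) / (bw d)\<^sup>2)
            * permuted (U_CQ d m n) m \<rho> (pooled m (X d) (Y d)) \<omega>)
       (\<lambda>d. 1 / sqrt (real d))"
proof -
  define Z where "Z d = pooled m (X d) (Y d)" for d
  define s where "s d = 2 * trace_d d (cov_mat (PX d))" for d
  define x y where "x d \<omega> i = Z d (\<rho> i) \<omega>" and "y d \<omega> j = Z d (\<rho> (m + j)) \<omega>" for d \<omega> i j
  define close where "close d \<omega> e \<longleftrightarrow> dists_close d m n (x d \<omega>) (y d \<omega>) (s d) e" for d \<omega> e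
  have perm: "permuted U m \<rho> (pooled m (X d) (Y d)) \<omega> = U (x d \<omega>) (y d \<omega>)" for U d \<omega>
  proof -
    have "x d \<omega> = (\<lambda>i. Z d (\<rho> i) \<omega>)" "y d \<omega> = (\<lambda>j. Z d (\<rho> (m + j)) \<omega>)"
      by (simp_all add: fun_eq_iff x_def y_def)
    then show ?thesis by (simp add: permuted_def Z_def)
  qed
  have prob: "prob_space (M d)" and Z: "k \<in> {1..m + n} \<Longrightarrow> Z d k \<in> measurable (M d) (Rd d)"
    if "d \<ge> 1" for d k
  proof -
    show M: "prob_space (M d)" using assms(5)[OF that] by (simp add: two_samples_def)
    show "k \<in> {1..m + n} \<Longrightarrow> Z d k \<in> measurable (M d) (Rd d)"
      using assms(5)[OF that] by (auto simp: two_samples_def Z_def prob_space.indep_vars_def[OF M])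
  qed
  have \<rho>_in: "\<rho> k \<in> {1..m + n}" if "k \<in> {1..m + n}" for k
    using permutes_in_image[OF assms(10)] that by blast
  have \<rho>_neq: "\<rho> k \<noteq> \<rho> l" if "k \<noteq> l" for k l
    using permutes_inj[OF assms(10)] that by (auto dest: injD)
  have xm: "i \<in> {1..m} \<Longrightarrow> (\<lambda>\<omega>. x d \<omega> i) \<in> measurable (M d) (Rd d)"
    and ym: "j \<in> {1..n} \<Longrightarrow> (\<lambda>\<omega>. y d \<omega> j) \<in> measurable (M d) (Rd d)" if "d \<ge> 1" for d i j
    using Z[OF that \<rho>_in, of i] Z[OF that \<rho>_in, of "m + j"] by (auto simp: x_def y_def)
  note meas = statistics_measurable[OF xm ym]
  \<comment> \<open>Reduces each claim to an estimate on the event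
    \<open>close d \<omega> (K * sqrt d)\<close>. The factor \<open>a\<close> is
    \<open>sqrt d\<close> for three statistics and 1 for energy.\<close>
  have dom: "bigo_prob M (\<lambda>d \<omega>. a d * U d (x d \<omega>) (y d \<omega>) - b d * U_CQ d m n (x d \<omega>) (y d \<omega>))
      (\<lambda>d. 1 / sqrt (real d))"
    if U_meas: "\<And>d. d \<ge> 1 \<Longrightarrow> (\<lambda>\<omega>. U d (x d \<omega>) (y d \<omega>)) \<in> borel_measurable (M d)"
      and bound: "\<And>K. K > 0 \<Longrightarrow> \<exists>C>0. \<forall>\<^sub>F d in sequentially. \<forall>\<omega>. close d \<omega> (K * sqrt d) \<longrightarrow>
        \<bar>a d * U d (x d \<omega>) (y d \<omega>) - b d * U_CQ d m n (x d \<omega>) (y d \<omega>)\<bar> \<le> C * (1 / sqrt d)"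
    for a b :: "nat \<Rightarrow> real" and U
  proof (rule bigo_prob_dominated)
    define I where "I = {(k, l). k \<in> {1..m + n} \<and> l \<in> {1..m + n} \<and> k \<noteq> l}"
    define e where "e = (\<lambda>(k, l) d \<omega>. (norm_d d (Z d k \<omega> - Z d l \<omega>))\<^sup>2 - s d)"
    show "finite I"
      by (rule finite_subset[of _ "{1..m + n} \<times> {1..m + n}"]) (auto simp: I_def)
    show "\<forall>\<^sub>F d in sequentially. prob_space (M d)"
      using eventually_ge_at_top[of 1] by eventually_elim (rule prob)
    show "bigo_prob M (e p) (\<lambda>d. sqrt (real d))" if "p \<in> I" for p
      using that pooled_dist_bigo[OF assms(3,4,5,6,9), of "fst p" "snd p"]
      by (auto simp: I_def e_def Z_def s_def)
    show "\<forall>\<^sub>F d in sequentially.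
      (\<lambda>\<omega>. a d * U d (x d \<omega>) (y d \<omega>) - b d * U_CQ d m n (x d \<omega>) (y d \<omega>)) \<in> borel_measurable (M d)"
      using eventually_ge_at_top[of 1]
    proof eventually_elim
      case (elim d)
      have "(\<lambda>\<omega>. U_CQ d m n (x d \<omega>) (y d \<omega>)) \<in> borel_measurable (M d)"
        by (rule meas(2)[OF elim _ elim])
      with U_meas[OF elim] show ?case by measurable
    qed
    fix K :: real assume "K > 0"
    from bound[OF this] obtain C where C: "C > 0" "\<forall>\<^sub>F d in sequentially. \<forall>\<omega>. close d \<omega> (K * sqrt d) \<longrightarrow>
        \<bar>a d * U d (x d \<omega>) (y d \<omega>) - b d * U_CQ d m n (x d \<omega>) (y d \<omega>)\<bar> \<le> C * (1 / sqrt d)"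
      by blast
    \<comment> \<open>Injectivity of \<open>\<rho>\<close> sends distinct positions to distinct
      pooled indices, and \<open>I\<close> contains all such pairs; here the permutation is
      absorbed.\<close>
    have "close d \<omega> (K * sqrt d)" if "\<forall>p\<in>I. \<bar>e p d \<omega>\<bar> \<le> K * \<bar>sqrt d\<bar>" for d \<omega>
    proof -
      have *: "\<bar>(norm_d d (Z d (\<rho> k) \<omega> - Z d (\<rho> l) \<omega>))\<^sup>2 - s d\<bar> \<le> K * sqrt d"
        if "k \<in> {1..m + n}" "l \<in> {1..m + n}" "k \<noteq> l" for k l
        using \<open>\<forall>p\<in>I. _\<close>[rule_format, of "(\<rho> k, \<rho> l)"] \<rho>_in that \<rho>_neq by (simp add: I_def e_def)
      show ?thesis unfolding close_def dists_close_def x_def y_def by (intro conjI ballI *) auto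
    qed
    with C show "\<exists>C>0. \<forall>\<^sub>F d in sequentially. \<forall>\<omega>\<in>space (M d). (\<forall>p\<in>I. \<bar>e p d \<omega>\<bar> \<le> K * \<bar>sqrt d\<bar>) \<longrightarrow>
        \<bar>a d * U d (x d \<omega>) (y d \<omega>) - b d * U_CQ d m n (x d \<omega>) (y d \<omega>)\<bar> \<le> C * \<bar>1 / sqrt d\<bar>"
      by (intro exI[of _ C] conjI) (auto elim!: eventually_mono)
  qed
  define c where "c = \<sigma>X2"
  have c: "c > 0" and lim: "(\<lambda>d. sigma2_d d (PX d)) \<longlonglongrightarrow> c"
    using assms(7) by (auto simp: condA2_def c_def sigma2_d_def)
  have sd: "s d = 2 * (d * sigma2_d d (PX d))" if "d \<ge> 1" for d
    using that by (simp add: s_def sigma2_d_def)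
  \<comment> \<open>Any margins around the positive limit would do; doubled by
    \<open>s d = 2 * (d * sigma2_d d (PX d))\<close>, these give \<open>c * d\<close> and
    \<open>4 * c * d\<close>.\<close>
  have "\<forall>\<^sub>F d in sequentially. c / 2 < sigma2_d d (PX d)" "\<forall>\<^sub>F d in sequentially. sigma2_d d (PX d) < 2 * c"
    using order_tendstoD(1)[OF lim, of "c / 2"] order_tendstoD(2)[OF lim, of "2 * c"] c by simp_all
  then have s_bounds: "\<forall>\<^sub>F d in sequentially. c * d \<le> s d \<and> s d \<le> 4 * c * d"
    using eventually_ge_at_top[of 1]
  proof eventually_elim
    case (elim d)
    have "d * (c / 2) \<le> d * sigma2_d d (PX d)" "d * sigma2_d d (PX d) \<le> d * (2 * c)"
      using elim c by (intro mult_left_mono; simp)+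
    then show ?case using sd[of d] elim c by (simp add: mult_ac)
  qed
  text \<open>The relative deviation of the squared distances from \<open>s d\<close> on the event \<open>close d \<omega> (K * sqrt d)\<close>.\<close>
  define \<tau> where "\<tau> K d = K / (c * sqrt d)" for K and d :: nat
  have \<tau>_sq: "(\<tau> K d)\<^sup>2 = K\<^sup>2 / c\<^sup>2 / d" for K d
    by (simp add: \<tau>_def power_divide power_mult_distrib)
  have small: "\<forall>\<^sub>F d in sequentially. B / sqrt d \<le> \<epsilon>" if "\<epsilon> > 0" for B \<epsilon> :: real
  proof -
    have "(\<lambda>d. B / sqrt (real d)) \<longlonglongrightarrow> 0" by real_asymp
    from order_tendstoD(2)[OF this that] show ?thesis by eventually_elim simp
  qed
  have regime: "\<forall>\<^sub>F d in sequentially. d \<ge> 1 \<and> s d > 0 \<and> s d \<le> 4 * c * d \<and> s d = 2 * (d * sigma2_d d (PX d)) \<and>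
      \<tau> K d \<le> 1 / 16 \<and> (\<forall>\<omega>. close d \<omega> (K * sqrt d) \<longrightarrow> close d \<omega> (\<tau> K d * s d))"
    if "K > 0" for K
    using s_bounds eventually_ge_at_top[of 1] small[of "1 / 16" "K / c", simplified]
  proof eventually_elim
    case (elim d)
    \<comment> \<open>The lower bound \<open>c * d \<le> s d\<close> converts the absolute tolerance
      into a relative one.\<close>
    have "K * sqrt d = \<tau> K d * (c * d)" using elim c by (simp add: \<tau>_def field_simps)
    also have "\<dots> \<le> \<tau> K d * s d" using elim c that by (intro mult_left_mono) (auto simp: \<tau>_def)
    finally have "close d \<omega> (K * sqrt d) \<longrightarrow> close d \<omega> (\<tau> K d * s d)" for \<omega>
      unfolding close_def using dists_close_mono by blast
    moreover have "0 < c * d" using c elim by simp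
    then have "0 < s d" using elim by linarith
    moreover have "\<tau> K d \<le> 1 / 16" using elim by (simp add: \<tau>_def)
    ultimately show ?case using elim sd[of d] by blast
  qed
  have sqrt_mult: "sqrt d * (B / d) = B * (1 / sqrt d)" for d :: nat and B :: real
    by (cases "d = 0") (auto simp: field_simps)
  have inv_sqrt: "sqrt d * (1 / q) = 1 / (sqrt d * r)" if "q = d * r" for d :: nat and q r :: real
  proof -
    have "sqrt d * (1 / q) = (sqrt d / d) * (1 / r)" unfolding that by simp
    also have "sqrt d / d = 1 / sqrt d" by (simp add: sqrt_divide_self_eq inverse_eq_divide)
    finally show ?thesis by simp
  qed
  have scale: "\<bar>sqrt d * u - b * v\<bar> \<le> B * (1 / sqrt d)"
    if "\<bar>u - b' * v\<bar> \<le> B / d" "b = sqrt d * b'" for d :: nat and u b b' v B :: real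
  proof -
    have "sqrt d * u - b * v = sqrt d * (u - b' * v)"
      unfolding that(2) by (simp add: algebra_simps)
    then have "\<bar>sqrt d * u - b * v\<bar> = sqrt d * \<bar>u - b' * v\<bar>" by (simp only: abs_mult) simp
    also have "\<dots> \<le> sqrt d * (B / d)" using that(1) by (intro mult_left_mono) auto
    finally show ?thesis unfolding sqrt_mult .
  qed

  have CvM: "bigo_prob M (\<lambda>d \<omega>. sqrt (real d) * U_CvM d m n (x d \<omega>) (y d \<omega>)
      - 1 / (2 * pi * sqrt (3 * real d) * sigma2_d d (PX d)) * U_CQ d m n (x d \<omega>) (y d \<omega>)) (\<lambda>d. 1 / sqrt (real d))"
  proof (rule dom)
    show "(\<lambda>\<omega>. U_CvM d m n (x d \<omega>) (y d \<omega>)) \<in> borel_measurable (M d)" if "d \<ge> 1" for d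
      by (rule meas(1)[OF that _ that])
    fix K :: real assume K: "K > 0"
    show "\<exists>C>0. \<forall>\<^sub>F d in sequentially. \<forall>\<omega>. close d \<omega> (K * sqrt d) \<longrightarrow>
      \<bar>sqrt d * U_CvM d m n (x d \<omega>) (y d \<omega>)
        - 1 / (2 * pi * sqrt (3 * real d) * sigma2_d d (PX d)) * U_CQ d m n (x d \<omega>) (y d \<omega>)\<bar> \<le> C * (1 / sqrt d)"
    \<comment> \<open>The witness is \<open>40 * (\<tau> K d)\<^sup>2\<close> with its factor
      \<open>1 / d\<close> removed.\<close>
    proof (intro exI[of _ "40 * K\<^sup>2 / c\<^sup>2"] conjI)
      show "\<forall>\<^sub>F d in sequentially. \<forall>\<omega>. close d \<omega> (K * sqrt d) \<longrightarrow>
        \<bar>sqrt d * U_CvM d m n (x d \<omega>) (y d \<omega>)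
          - 1 / (2 * pi * sqrt (3 * real d) * sigma2_d d (PX d)) * U_CQ d m n (x d \<omega>) (y d \<omega>)\<bar>
          \<le> 40 * K\<^sup>2 / c\<^sup>2 * (1 / sqrt d)"
      proof (rule eventually_mono[OF regime[OF K]], intro allI impI, goal_cases)
        case elim: (1 d \<omega>)
        have "\<bar>U_CvM d m n (x d \<omega>) (y d \<omega>) - 1 / (pi * sqrt 3 * s d) * U_CQ d m n (x d \<omega>) (y d \<omega>)\<bar>
          \<le> 40 * (\<tau> K d)\<^sup>2"
          using elim by (intro U_CvM_approx assms) (auto simp: close_def)
        then show ?case
        proof (intro scale)
          have "sqrt d * (1 / (pi * sqrt 3 * s d)) = 1 / (sqrt d * (2 * pi * sqrt 3 * sigma2_d d (PX d)))"
            using elim by (intro inv_sqrt) (simp only: mult_ac)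
          also have "\<dots> = 1 / (2 * pi * sqrt (3 * real d) * sigma2_d d (PX d))"
            by (simp add: real_sqrt_mult mult_ac)
          finally show "1 / (2 * pi * sqrt (3 * real d) * sigma2_d d (PX d)) = sqrt d * (1 / (pi * sqrt 3 * s d))" ..
        qed (simp add: \<tau>_sq)
      qed
    qed (use K c in auto)
  qed

  have WMW: "bigo_prob M (\<lambda>d \<omega>. sqrt (real d) * U_WMW d m n (x d \<omega>) (y d \<omega>)
      - 1 / (2 * sqrt (real d) * sigma2_d d (PX d)) * U_CQ d m n (x d \<omega>) (y d \<omega>)) (\<lambda>d. 1 / sqrt (real d))"
  proof (rule dom)
    show "(\<lambda>\<omega>. U_WMW d m n (x d \<omega>) (y d \<omega>)) \<in> borel_measurable (M d)" if "d \<ge> 1" for d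
      by (rule meas(3)[OF that _ that])
    fix K :: real assume K: "K > 0"
    show "\<exists>C>0. \<forall>\<^sub>F d in sequentially. \<forall>\<omega>. close d \<omega> (K * sqrt d) \<longrightarrow>
      \<bar>sqrt d * U_WMW d m n (x d \<omega>) (y d \<omega>)
        - 1 / (2 * sqrt (real d) * sigma2_d d (PX d)) * U_CQ d m n (x d \<omega>) (y d \<omega>)\<bar> \<le> C * (1 / sqrt d)"
    proof (intro exI[of _ "4 * K\<^sup>2 / c\<^sup>2"] conjI)
      show "\<forall>\<^sub>F d in sequentially. \<forall>\<omega>. close d \<omega> (K * sqrt d) \<longrightarrow>
        \<bar>sqrt d * U_WMW d m n (x d \<omega>) (y d \<omega>)
          - 1 / (2 * sqrt (real d) * sigma2_d d (PX d)) * U_CQ d m n (x d \<omega>) (y d \<omega>)\<bar>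
          \<le> 4 * K\<^sup>2 / c\<^sup>2 * (1 / sqrt d)"
      proof (rule eventually_mono[OF regime[OF K]], intro allI impI, goal_cases)
        case elim: (1 d \<omega>)
        have "\<bar>U_WMW d m n (x d \<omega>) (y d \<omega>) - 1 / s d * U_CQ d m n (x d \<omega>) (y d \<omega>)\<bar> \<le> 4 * (\<tau> K d)\<^sup>2"
          using elim by (intro U_WMW_approx assms) (auto simp: close_def)
        then show ?case
        proof (intro scale)
          have "sqrt d * (1 / s d) = 1 / (sqrt d * (2 * sigma2_d d (PX d)))"
            using elim by (intro inv_sqrt) (simp only: mult_ac)
          also have "\<dots> = 1 / (2 * sqrt (real d) * sigma2_d d (PX d))"
            by (simp add: mult_ac)
          finally show "1 / (2 * sqrt (real d) * sigma2_d d (PX d)) = sqrt d * (1 / s d)" ..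
        qed (simp add: \<tau>_sq)
      qed
    qed (use K c in auto)
  qed

  have Energy: "bigo_prob M (\<lambda>d \<omega>. 1 * U_Energy d m n (x d \<omega>) (y d \<omega>)
      - 1 / (sqrt (2 * real d) * sqrt (sigma2_d d (PX d))) * U_CQ d m n (x d \<omega>) (y d \<omega>)) (\<lambda>d. 1 / sqrt (real d))"
  proof (rule dom)
    show "(\<lambda>\<omega>. U_Energy d m n (x d \<omega>) (y d \<omega>)) \<in> borel_measurable (M d)" if "d \<ge> 1" for d
      by (rule meas(4)[OF that _ that])
    fix K :: real assume K: "K > 0"
    show "\<exists>C>0. \<forall>\<^sub>F d in sequentially. \<forall>\<omega>. close d \<omega> (K * sqrt d) \<longrightarrow>
      \<bar>1 * U_Energy d m n (x d \<omega>) (y d \<omega>)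
        - 1 / (sqrt (2 * real d) * sqrt (sigma2_d d (PX d))) * U_CQ d m n (x d \<omega>) (y d \<omega>)\<bar> \<le> C * (1 / sqrt d)"
    \<comment> \<open>The remainder \<open>2 * (sqrt (s d) * (\<tau> K d)\<^sup>2)\<close> is
      estimated by \<open>s d \<le> 4 * c * d\<close>; \<open>sqrt (s d)\<close> supplies the factor
      \<open>sqrt d\<close> that the other statistics receive from outside.\<close>
    proof (intro exI[of _ "2 * sqrt (4 * c) * K\<^sup>2 / c\<^sup>2"] conjI)
      show "\<forall>\<^sub>F d in sequentially. \<forall>\<omega>. close d \<omega> (K * sqrt d) \<longrightarrow>
        \<bar>1 * U_Energy d m n (x d \<omega>) (y d \<omega>)
          - 1 / (sqrt (2 * real d) * sqrt (sigma2_d d (PX d))) * U_CQ d m n (x d \<omega>) (y d \<omega>)\<bar>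
          \<le> 2 * sqrt (4 * c) * K\<^sup>2 / c\<^sup>2 * (1 / sqrt d)"
      proof (rule eventually_mono[OF regime[OF K]], intro allI impI, goal_cases)
        case elim: (1 d \<omega>)
        have "\<bar>U_Energy d m n (x d \<omega>) (y d \<omega>) - 1 / sqrt (s d) * U_CQ d m n (x d \<omega>) (y d \<omega>)\<bar>
          \<le> 2 * (sqrt (s d) * (\<tau> K d)\<^sup>2)"
          using elim by (intro U_Energy_approx assms) (auto simp: close_def)
        also have "\<dots> \<le> 2 * (sqrt (4 * c * d) * (\<tau> K d)\<^sup>2)"
          using elim by (intro mult_left_mono mult_right_mono real_sqrt_le_mono) auto
        also have "\<dots> = sqrt d * (2 * sqrt (4 * c) * K\<^sup>2 / c\<^sup>2 / d)"
          unfolding \<tau>_sq by (simp add: real_sqrt_mult)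
        also have "\<dots> = 2 * sqrt (4 * c) * K\<^sup>2 / c\<^sup>2 * (1 / sqrt d)" by (rule sqrt_mult)
        finally show ?case using elim by (simp add: real_sqrt_mult mult.assoc)
      qed
    qed (use K c in auto)
  qed

  have MMD: "bigo_prob M (\<lambda>d \<omega>. sqrt (real d) * U_MMD d (bw d) m n (x d \<omega>) (y d \<omega>)
      - sqrt (real d) / (bw d)\<^sup>2 * exp (- (real d * sigma2_d d (PX d)) / (bw d)\<^sup>2)
        * U_CQ d m n (x d \<omega>) (y d \<omega>)) (\<lambda>d. 1 / sqrt (real d))"
  proof (rule dom)
    show "(\<lambda>\<omega>. U_MMD d (bw d) m n (x d \<omega>) (y d \<omega>)) \<in> borel_measurable (M d)" if "d \<ge> 1" for d
      by (rule meas(5)[OF that _ that])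
    from assms(11) obtain h where h: "h > 0" "\<forall>\<^sub>F d in sequentially. h < \<bar>(bw d)\<^sup>2 / d\<bar>"
      unfolding same_order_def eventually_conj_iff by blast
    fix K :: real assume K: "K > 0"
    show "\<exists>C>0. \<forall>\<^sub>F d in sequentially. \<forall>\<omega>. close d \<omega> (K * sqrt d) \<longrightarrow>
      \<bar>sqrt d * U_MMD d (bw d) m n (x d \<omega>) (y d \<omega>)
        - sqrt (real d) / (bw d)\<^sup>2 * exp (- (real d * sigma2_d d (PX d)) / (bw d)\<^sup>2)
          * U_CQ d m n (x d \<omega>) (y d \<omega>)\<bar> \<le> C * (1 / sqrt d)"
    proof (intro exI[of _ "12 * K\<^sup>2 / h\<^sup>2"] conjI)
      show "\<forall>\<^sub>F d in sequentially. \<forall>\<omega>. close d \<omega> (K * sqrt d) \<longrightarrow>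
        \<bar>sqrt d * U_MMD d (bw d) m n (x d \<omega>) (y d \<omega>)
          - sqrt (real d) / (bw d)\<^sup>2 * exp (- (real d * sigma2_d d (PX d)) / (bw d)\<^sup>2)
            * U_CQ d m n (x d \<omega>) (y d \<omega>)\<bar> \<le> 12 * K\<^sup>2 / h\<^sup>2 * (1 / sqrt d)"
      proof (rule eventually_mono[OF eventually_conj[OF regime[OF K]
            eventually_conj[OF h(2) small[OF zero_less_one, of "K / h"]]]], intro allI impI, goal_cases)
        case elim: (1 d \<omega>)
        \<comment> \<open>The counterpart of \<open>\<tau>\<close> on the bandwidth scale:
          \<open>h\<close> is the lower constant in \<open>same_order\<close>, so
          \<open>h * d < (bw d)\<^sup>2\<close> plays the part of
          \<open>c * d \<le> s d\<close>.\<close>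
        define \<eta> where "\<eta> = K / (h * sqrt d)"
        have \<eta>: "\<eta> \<ge> 0" "\<eta> \<le> 1" "\<eta>\<^sup>2 = K\<^sup>2 / h\<^sup>2 / d"
          using K h(1) elim by (simp_all add: \<eta>_def power_divide power_mult_distrib)
        have "0 < real d" "h < (bw d)\<^sup>2 / d" using elim by auto
        then have bw: "h * d < (bw d)\<^sup>2" by (simp add: pos_less_divide_eq)
        have "K * sqrt d = \<eta> * (h * d)" using elim h(1) by (simp add: \<eta>_def field_simps)
        also have "\<dots> \<le> \<eta> * (bw d)\<^sup>2" using bw \<eta> by (intro mult_left_mono) auto
        finally have "dists_close d m n (x d \<omega>) (y d \<omega>) (s d) (\<eta> * (bw d)\<^sup>2)"
          using elim dists_close_mono unfolding close_def by blast
        moreover have "0 < (bw d)\<^sup>2" 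
          using le_less_trans[OF _ bw, of 0] h(1) by simp
        ultimately have "\<bar>U_MMD d (bw d) m n (x d \<omega>) (y d \<omega>)
          - exp (- s d / (2 * (bw d)\<^sup>2)) / (bw d)\<^sup>2 * U_CQ d m n (x d \<omega>) (y d \<omega>)\<bar> \<le> 12 * \<eta>\<^sup>2"
          using elim \<eta> by (intro U_MMD_approx assms) auto
        then show ?case
        proof (intro scale)
          have "- s d / (2 * (bw d)\<^sup>2) = - (real d * sigma2_d d (PX d)) / (bw d)\<^sup>2" using elim by simp
          then show "sqrt (real d) / (bw d)\<^sup>2 * exp (- (real d * sigma2_d d (PX d)) / (bw d)\<^sup>2)
            = sqrt d * (exp (- s d / (2 * (bw d)\<^sup>2)) / (bw d)\<^sup>2)" by simp
        qed (simp add: \<eta>)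
      qed
    qed (use K h in auto)
  qed

  show ?thesis unfolding perm using CvM Energy WMW MMD by simp
qed

end
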